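(* Let $(X,d)$ be a Busemann space and let $\omega\colon\mathbb{R}\to X$ be a geodesic. Let $g\colon X_\omega\to X_\omega$ be an isometry preserving the foliation by $\omega$. Then $g$ induces an isometry $g_\omega\colon\mathbb{X}_\omega(\mathbb{R})\to\mathbb{X}_\omega(\mathbb{R})$ by $g_\omega(L)=g(L)$ for $L\in\mathbb{X}_\omega(\mathbb{R})$. Moreover, the following hold. (1) If $g$ is elliptic, then so is $g_\omega$. (2) If $g_\omega$ is elliptic, then $g$ is either elliptic or hyperbolic. (3) Suppose $g$ is hyperbolic, and let $\xi\colon\mathbb{R}\to X$ be an axis of $g$. If $\xi$ is parallel to either $\omega$ or $\bar\omega$, then $g_\omega$ is elliptic. Otherwise, $g_\omega$ is hyperbolic. (4) If $g_\omega$ is hyperbolic, then so is $g$. In particular, $g$ is semi-simple if and only if $g_\omega$ is semi-simple.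
   Context: Let $(X,d)$ be a metric space. A map $\gamma\colon I\to X$ on a closed interval $I\subset\mathbb{R}$ (possibly $I=\mathbb{R}$) is a geodesic if $d(\gamma(s),\gamma(t))=|t-s|$ for all $s,t\in I$. $X$ is a geodesic space if any two points are joined by a geodesic. A linearly reparametrised geodesic is a map of the form $t\mapsto\gamma(\lambda t)$ with $\gamma$ a geodesic and $\lambda>0$. A geodesic space is a Busemann space if for any two linearly reparametrised geodesics $\gamma,\eta\colon[0,1]\to X$ the function $t\mapsto d(\gamma(t),\eta(t))$ is convex on $[0,1]$. Two geodesics $\gamma,\eta\colon\mathbb{R}\to X$ are parallel if $d(\gamma(t),\eta(t))$ is bounded in $t\in\mathbb{R}$. $X_\omega\subset X$ denotes the union of the images of all geodesics $\gamma\colon\mathbb{R}\to X$ parallel to $\omega$ (with the restricted metric), and $\mathbb{X}_\omega(\mathbb{R})$ denotes the set of images $\gamma(\mathbb{R})$ of all such geodesics, equipped with the Hausdorff metric. $\bar\omega$ is the geodesic $\bar\omega(t)=\omega(-t)$. An isometry $g\colon X_\omega\to X_\omega$ preserves the foliation by $\omega$ if $g\circ\omega$ or $g\circ\bar\omega$ is parallel to $\omega$. For an isometry $f\colon Y\to Y$ of a metric space $(Y,d)$, let $|f|=\inf_{y\in Y}d(y,f(y))$ and $\mathrm{Min}(f)=\{y\in Y: d(y,f(y))=|f|\}$. The isometry $f$ is elliptic if $\mathrm{Min}(f)\neq\emptyset$ and $|f|=0$ (equivalently, $f$ has a fixed point); hyperbolic if $\mathrm{Min}(f)\neq\emptyset$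 and $|f|>0$; semi-simple if it is elliptic or hyperbolic. If $f$ has no fixed point, an axis of $f$ is a geodesic $\mathbb{R}\to Y$ whose image is setwise invariant under $f$. *)

theory Defs
  imports "HOL-Analysis.Analysis"
begin

text \<open>
  A metric space is a carrier \<open>M\<close> with a distance function \<open>d\<close>, as in the library locale
  \<open>Metric_space\<close>, so that the same notions apply to a space, to its subspaces (same \<open>d\<close>, smaller
  carrier) and to a space of lines with the Hausdorff metric. A map into or between metric spaces
  is a total HOL function of which only the values on the domain in question are constrained.
\<close>

definition geodesic_on :: "'a set \<Rightarrow> ('a \<Rightarrow> 'a \<Rightarrow> real) \<Rightarrow> real set \<Rightarrow> (real \<Rightarrow> 'a) \<Rightarrow> bool" where
  "geodesic_on M d I \<gamma> \<longleftrightarrow>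
     is_interval I \<and> closed I \<and> \<gamma> ` I \<subseteq> M \<and>
     (\<forall>s\<in>I. \<forall>t\<in>I. d (\<gamma> s) (\<gamma> t) = \<bar>t - s\<bar>)"

abbreviation geodesic_line :: "'a set \<Rightarrow> ('a \<Rightarrow> 'a \<Rightarrow> real) \<Rightarrow> (real \<Rightarrow> 'a) \<Rightarrow> bool" where
  "geodesic_line M d \<gamma> \<equiv> geodesic_on M d UNIV \<gamma>"

definition reparam_geodesic01 :: "'a set \<Rightarrow> ('a \<Rightarrow> 'a \<Rightarrow> real) \<Rightarrow> (real \<Rightarrow> 'a) \<Rightarrow> bool" where
  "reparam_geodesic01 M d \<gamma> \<longleftrightarrow>
     (\<exists>I c l. l > 0 \<and> geodesic_on M d I c \<and> (\<forall>t\<in>{0..1}. l * t \<in> I \<and> \<gamma> t = c (l * t)))"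

locale geodesic_space = Metric_space M d for M :: "'a set" and d :: "'a \<Rightarrow> 'a \<Rightarrow> real" +
  assumes geodesic_exists:
    "x \<in> M \<Longrightarrow> y \<in> M \<Longrightarrow> \<exists>a b \<gamma>. a \<le> b \<and> geodesic_on M d {a..b} \<gamma> \<and> \<gamma> a = x \<and> \<gamma> b = y"

locale busemann_space = geodesic_space M d for M :: "'a set" and d :: "'a \<Rightarrow> 'a \<Rightarrow> real" +
  assumes busemann_convex:
    "reparam_geodesic01 M d \<gamma> \<Longrightarrow> reparam_geodesic01 M d \<eta>
       \<Longrightarrow> convex_on {0..1} (\<lambda>t. d (\<gamma> t) (\<eta> t))"

definition parallel :: "('a \<Rightarrow> 'a \<Rightarrow> real) \<Rightarrow> (real \<Rightarrow> 'a) \<Rightarrow> (real \<Rightarrow> 'a) \<Rightarrow> bool" where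
  "parallel d \<gamma> \<eta> \<longleftrightarrow> bounded (range (\<lambda>t. d (\<gamma> t) (\<eta> t)))"

definition reverse_line :: "(real \<Rightarrow> 'a) \<Rightarrow> real \<Rightarrow> 'a" where
  "reverse_line \<omega> = (\<lambda>t. \<omega> (- t))"

definition parallel_geodesics ::
    "'a set \<Rightarrow> ('a \<Rightarrow> 'a \<Rightarrow> real) \<Rightarrow> (real \<Rightarrow> 'a) \<Rightarrow> (real \<Rightarrow> 'a) set" where
  "parallel_geodesics M d \<omega> = {\<gamma>. geodesic_line M d \<gamma> \<and> parallel d \<gamma> \<omega>}"

text \<open>The subspace \<open>X\<^sub>\<omega>\<close>; its metric is the restriction of \<open>d\<close>.\<close>

definition parallel_set :: "'a set \<Rightarrow> ('a \<Rightarrow> 'a \<Rightarrow> real) \<Rightarrow> (real \<Rightarrow> 'a) \<Rightarrow> 'a set" where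
  "parallel_set M d \<omega> = (\<Union>\<gamma>\<in>parallel_geodesics M d \<omega>. range \<gamma>)"

text \<open>The carrier of the space of lines parallel to \<open>\<omega>\<close>; its metric is \<open>hausdorff_dist d\<close>.\<close>

definition parallel_lines :: "'a set \<Rightarrow> ('a \<Rightarrow> 'a \<Rightarrow> real) \<Rightarrow> (real \<Rightarrow> 'a) \<Rightarrow> 'a set set" where
  "parallel_lines M d \<omega> = range ` parallel_geodesics M d \<omega>"

text \<open>
  Real-valued, hence meaningful only for nonempty sets at finite Hausdorff distance. Images of
  parallel geodesics are such sets.
\<close>

definition hausdorff_dist :: "('a \<Rightarrow> 'a \<Rightarrow> real) \<Rightarrow> 'a set \<Rightarrow> 'a set \<Rightarrow> real" where
  "hausdorff_dist d A B = max (SUP a\<in>A. INF b\<in>B. d a b) (SUP b\<in>B. INF a\<in>A. d a b)"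

definition isometry_of :: "'a set \<Rightarrow> ('a \<Rightarrow> 'a \<Rightarrow> real) \<Rightarrow> ('a \<Rightarrow> 'a) \<Rightarrow> bool" where
  "isometry_of Y d f \<longleftrightarrow> bij_betw f Y Y \<and> (\<forall>x\<in>Y. \<forall>y\<in>Y. d (f x) (f y) = d x y)"

definition preserves_foliation ::
    "('a \<Rightarrow> 'a \<Rightarrow> real) \<Rightarrow> (real \<Rightarrow> 'a) \<Rightarrow> ('a \<Rightarrow> 'a) \<Rightarrow> bool" where
  "preserves_foliation d \<omega> g \<longleftrightarrow> parallel d (g \<circ> \<omega>) \<omega> \<or> parallel d (g \<circ> reverse_line \<omega>) \<omega>"

definition min_displacement :: "'a set \<Rightarrow> ('a \<Rightarrow> 'a \<Rightarrow> real) \<Rightarrow> ('a \<Rightarrow> 'a) \<Rightarrow> real" where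
  "min_displacement Y d f = (INF y\<in>Y. d y (f y))"

definition min_set :: "'a set \<Rightarrow> ('a \<Rightarrow> 'a \<Rightarrow> real) \<Rightarrow> ('a \<Rightarrow> 'a) \<Rightarrow> 'a set" where
  "min_set Y d f = {y \<in> Y. d y (f y) = min_displacement Y d f}"

definition elliptic :: "'a set \<Rightarrow> ('a \<Rightarrow> 'a \<Rightarrow> real) \<Rightarrow> ('a \<Rightarrow> 'a) \<Rightarrow> bool" where
  "elliptic Y d f \<longleftrightarrow> min_set Y d f \<noteq> {} \<and> min_displacement Y d f = 0"

definition hyperbolic :: "'a set \<Rightarrow> ('a \<Rightarrow> 'a \<Rightarrow> real) \<Rightarrow> ('a \<Rightarrow> 'a) \<Rightarrow> bool" where
  "hyperbolic Y d f \<longleftrightarrow> min_set Y d f \<noteq> {} \<and> min_displacement Y d f > 0"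

definition semisimple :: "'a set \<Rightarrow> ('a \<Rightarrow> 'a \<Rightarrow> real) \<Rightarrow> ('a \<Rightarrow> 'a) \<Rightarrow> bool" where
  "semisimple Y d f \<longleftrightarrow> elliptic Y d f \<or> hyperbolic Y d f"

definition axis_of :: "'a set \<Rightarrow> ('a \<Rightarrow> 'a \<Rightarrow> real) \<Rightarrow> ('a \<Rightarrow> 'a) \<Rightarrow> (real \<Rightarrow> 'a) \<Rightarrow> bool" where
  "axis_of Y d f \<xi> \<longleftrightarrow>
     (\<forall>y\<in>Y. f y \<noteq> y) \<and> geodesic_line Y d \<xi> \<and> f ` range \<xi> = range \<xi>"

end

theory Submission
  imports Defs
begin

text \<open>
  Only midpoints are used, so neither completeness nor the full flat strip theorem is needed. The
  midpoints of corresponding points of two parallel lines form a third parallel line, which is also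
  the set of all midpoints between points of the two lines. Hence \<open>X\<^sub>\<omega>\<close> is closed under midpoints,
  and passing from a point to the line through it sends midpoints to midpoints.

  If \<open>f x\<close> is the midpoint of \<open>x\<close> and \<open>f (f x)\<close>, convexity gives \<open>d x (f\<^sup>n x) = n * d x (f x)\<close>, and an
  orbit growing linearly in this way realises the minimal displacement. Minimal points of \<open>g\<close> have
  such orbits, and the lines through them have such orbits under \<open>g\<^sub>\<omega>\<close>. Conversely, if the line \<open>L\<close> is
  minimal for \<open>g\<^sub>\<omega>\<close>, then \<open>g L\<close> is the midline of \<open>L\<close> and \<open>g (g L)\<close>, and some \<open>x\<close> on \<open>L\<close> has \<open>g x\<close> as
  midpoint of \<open>x\<close> and \<open>g (g x)\<close>.
\<close>

section \<open>Midpoint convexity\<close>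

text \<open>The increments of a midpoint-convex sequence are nondecreasing, so each is at least the
  first one.\<close>

lemma midpoint_convex_seq:
  fixes a :: "nat \<Rightarrow> real"
  assumes "\<And>n. 2 * a (Suc n) \<le> a n + a (Suc (Suc n))"
  shows "a 0 + real n * (a 1 - a 0) \<le> a n"
proof -
  have inc: "a 1 - a 0 \<le> a (Suc n) - a n" for n
  proof (induction n)
    case (Suc n)
    with assms[of n] show ?case by linarith
  qed simp
  show ?thesis
  proof (induction n)
    case (Suc n)
    with inc[of n] show ?case by (simp add: algebra_simps)
  qed simp
qed

text \<open>If \<open>f a < f b\<close>, the values along the arithmetic progression
  \<open>a\<close>, \<open>b\<close>, \<open>2 * b - a\<close>, ... grow at least linearly and
  exceed any upper bound.\<close>

lemma midpoint_convex_bounded_const: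
  fixes f :: "real \<Rightarrow> real"
  assumes conv: "\<And>s t. 2 * f ((s + t) / 2) \<le> f s + f t" and bd: "\<And>t. f t \<le> B"
  shows "f s = f t"
proof -
  have "f b \<le> f a" for a b
  proof (rule ccontr)
    assume "\<not> f b \<le> f a"
    then obtain n :: nat where n: "B - f a < real n * (f b - f a)"
      using ex_less_of_nat_mult[of "f b - f a" "B - f a"] by auto
    define q where "q = (\<lambda>n::nat. f (a + real n * (b - a)))"
    have "2 * q (Suc n) \<le> q n + q (Suc (Suc n))" for n
    proof -
      have "((a + real n * (b - a)) + (a + real (Suc (Suc n)) * (b - a))) / 2 = a + real (Suc n) * (b - a)"
        by (simp add: field_simps)
      with conv[of "a + real n * (b - a)" "a + real (Suc (Suc n)) * (b - a)"]
      show ?thesis by (simp only: q_def)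
    qed
    from midpoint_convex_seq[of q n, OF this] have "f a + real n * (f b - f a) \<le> q n"
      by (simp add: q_def)
    with n bd[of "a + real n * (b - a)"] show False by (simp add: q_def)
  qed
  then show ?thesis by (simp add: order_antisym)
qed

text \<open>The sign is read off from \<open>\<phi> 1\<close>; the distances to
  \<open>\<phi> 0\<close> and \<open>\<phi> 1\<close> then leave only one value for
  \<open>\<phi> t\<close>.\<close>

lemma isometry_of_real:
  fixes \<phi> :: "real \<Rightarrow> real"
  assumes "\<And>s t. \<bar>\<phi> s - \<phi> t\<bar> = \<bar>s - t\<bar>"
  shows "(\<forall>t. \<phi> t = \<phi> 0 + t) \<or> (\<forall>t. \<phi> t = \<phi> 0 - t)"
proof (cases "\<phi> 1 = \<phi> 0 + 1")
  case True
  have "\<phi> t = \<phi> 0 + t" for t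
    using assms[of t 0] assms[of t 1] True by (auto simp: abs_if split: if_splits)
  then show ?thesis by blast
next
  case False
  then have *: "\<phi> 1 = \<phi> 0 - 1" using assms[of 1 0] by (auto simp: abs_if split: if_splits)
  have "\<phi> t = \<phi> 0 - t" for t
    using assms[of t 0] assms[of t 1] * by (auto simp: abs_if split: if_splits)
  then show ?thesis by blast
qed

section \<open>Displacement of an isometry\<close>

text \<open>
  The library locale \<open>Metric_space\<close> asks for symmetry and nonnegativity outside the carrier as
  well, which \<open>hausdorff_dist\<close> does not satisfy.
\<close>

locale carrier_metric =
  fixes Y :: "'b set" and \<delta> :: "'b \<Rightarrow> 'b \<Rightarrow> real"
  assumes nonneg_on: "\<lbrakk>x \<in> Y; y \<in> Y\<rbrakk> \<Longrightarrow> 0 \<le> \<delta> x y"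
    and zero_on: "\<lbrakk>x \<in> Y; y \<in> Y\<rbrakk> \<Longrightarrow> \<delta> x y = 0 \<longleftrightarrow> x = y"
    and commute_on: "\<lbrakk>x \<in> Y; y \<in> Y\<rbrakk> \<Longrightarrow> \<delta> x y = \<delta> y x"
    and triangle_on: "\<lbrakk>x \<in> Y; y \<in> Y; z \<in> Y\<rbrakk> \<Longrightarrow> \<delta> x z \<le> \<delta> x y + \<delta> y z"
begin

context
  fixes f
  assumes iso: "isometry_of Y \<delta> f"
begin

lemma isometry_closed: "x \<in> Y \<Longrightarrow> f x \<in> Y"
  using iso by (auto simp: isometry_of_def bij_betw_def)

lemma isometry_dist: "\<lbrakk>x \<in> Y; y \<in> Y\<rbrakk> \<Longrightarrow> \<delta> (f x) (f y) = \<delta> x y"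
  using iso by (simp add: isometry_of_def)

lemma funpow_closed: "x \<in> Y \<Longrightarrow> (f ^^ n) x \<in> Y"
  by (induction n) (auto intro: isometry_closed)

lemma funpow_dist: "\<lbrakk>x \<in> Y; y \<in> Y\<rbrakk> \<Longrightarrow> \<delta> ((f ^^ n) x) ((f ^^ n) y) = \<delta> x y"
  by (induction n) (auto simp: isometry_dist funpow_closed)

lemma funpow_displacement:
  assumes "x \<in> Y"
  shows "\<delta> x ((f ^^ n) x) \<le> real n * \<delta> x (f x)"
proof (induction n)
  case 0
  then show ?case using zero_on[OF assms assms] by simp
next
  case (Suc n)
  have "\<delta> x ((f ^^ Suc n) x) \<le> \<delta> x ((f ^^ n) x) + \<delta> ((f ^^ n) x) ((f ^^ n) (f x))"
    using triangle_on[OF assms funpow_closed[OF assms, of n] funpow_closed[OF assms, of "Suc n"]]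
    by (simp add: funpow_swap1)
  also have "\<delta> ((f ^^ n) x) ((f ^^ n) (f x)) = \<delta> x (f x)"
    using assms by (intro funpow_dist) (auto intro: isometry_closed)
  finally show ?case using Suc by (simp add: algebra_simps)
qed

text \<open>Orbits of \<open>x\<close> and \<open>z\<close> stay at distance
  \<open>\<delta> x z\<close>, so \<open>N * \<delta> x (f x)\<close> is at most
  \<open>2 * \<delta> x z + N * \<delta> z (f z)\<close>; large \<open>N\<close> decides. Growth is
  asked only along powers of two because for lines it is obtained by doubling.\<close>

lemma displacement_minimal:
  assumes x: "x \<in> Y" and z: "z \<in> Y"
    and pow: "\<And>k. \<delta> x ((f ^^ (2 ^ k)) x) = 2 ^ k * \<delta> x (f x)"
  shows "\<delta> x (f x) \<le> \<delta> z (f z)"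
proof (rule ccontr)
  assume "\<not> ?thesis"
  then obtain n :: nat where n: "2 * \<delta> x z < real n * (\<delta> x (f x) - \<delta> z (f z))"
    using ex_less_of_nat_mult[of "\<delta> x (f x) - \<delta> z (f z)" "2 * \<delta> x z"] by auto
  \<comment> \<open>A power of two that is at least \<open>n\<close>.\<close>
  define N :: nat where "N = 2 ^ n"
  have "real n \<le> real N" unfolding N_def by (simp add: less_imp_le)
  with \<open>\<not> ?thesis\<close> n have N: "2 * \<delta> x z < real N * (\<delta> x (f x) - \<delta> z (f z))"
    by (smt (verit) mult_right_mono)
  have "real N * \<delta> x (f x) = \<delta> x ((f ^^ N) x)" using pow[of n] by (simp add: N_def)
  also have "\<dots> \<le> \<delta> x z + (\<delta> z ((f ^^ N) z) + \<delta> ((f ^^ N) z) ((f ^^ N) x))"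
    using triangle_on[OF x z funpow_closed[OF x, of N]]
      triangle_on[OF z funpow_closed[OF z, of N] funpow_closed[OF x, of N]] by linarith
  also have "\<dots> \<le> 2 * \<delta> x z + real N * \<delta> z (f z)"
    using funpow_dist[OF z x, of N] commute_on[OF x z] funpow_displacement[OF z, of N] by linarith
  finally show False using N by (simp add: algebra_simps)
qed

lemma displacement_bdd_below: "bdd_below ((\<lambda>y. \<delta> y (f y)) ` Y)"
  by (rule bdd_belowI2[where m = 0]) (simp add: nonneg_on isometry_closed)

text \<open>Displacements are bounded below by zero, so the infimum behaves as expected and can be
  replaced by comparisons between points.\<close>

lemma min_set_iff: "y \<in> min_set Y \<delta> f \<longleftrightarrow> y \<in> Y \<and> (\<forall>z\<in>Y. \<delta> y (f y) \<le> \<delta> z (f z))"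
proof
  assume "y \<in> min_set Y \<delta> f"
  then show "y \<in> Y \<and> (\<forall>z\<in>Y. \<delta> y (f y) \<le> \<delta> z (f z))"
    by (auto simp: min_set_def min_displacement_def intro: cINF_lower[OF displacement_bdd_below])
next
  assume y: "y \<in> Y \<and> (\<forall>z\<in>Y. \<delta> y (f y) \<le> \<delta> z (f z))"
  then have "\<delta> y (f y) \<le> (INF z\<in>Y. \<delta> z (f z))" by (intro cINF_greatest) auto
  moreover have "(INF z\<in>Y. \<delta> z (f z)) \<le> \<delta> y (f y)"
    using y by (intro cINF_lower[OF displacement_bdd_below]) auto
  ultimately show "y \<in> min_set Y \<delta> f" using y by (simp add: min_set_def min_displacement_def)
qed

lemma elliptic_iff: "elliptic Y \<delta> f \<longleftrightarrow> (\<exists>y\<in>Y. f y = y)"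
proof
  assume "elliptic Y \<delta> f"
  then obtain y where "y \<in> Y" "\<delta> y (f y) = 0" by (auto simp: elliptic_def min_set_def)
  then show "\<exists>y\<in>Y. f y = y" using zero_on[of y "f y"] isometry_closed by metis
next
  assume "\<exists>y\<in>Y. f y = y"
  then obtain y where y: "y \<in> Y" "f y = y" by blast
  then have "\<delta> y (f y) = 0" using zero_on by simp
  with y have "y \<in> min_set Y \<delta> f" by (simp add: min_set_iff nonneg_on isometry_closed)
  with \<open>\<delta> y (f y) = 0\<close> show "elliptic Y \<delta> f" by (auto simp: elliptic_def min_set_def)
qed

lemma hyperbolic_iff:
  "hyperbolic Y \<delta> f \<longleftrightarrow> (\<exists>y\<in>Y. 0 < \<delta> y (f y) \<and> (\<forall>z\<in>Y. \<delta> y (f y) \<le> \<delta> z (f z)))"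
  (is "_ \<longleftrightarrow> ?R")
proof
  assume "hyperbolic Y \<delta> f"
  then obtain y where y: "y \<in> min_set Y \<delta> f" "0 < min_displacement Y \<delta> f"
    by (auto simp: hyperbolic_def)
  then have "0 < \<delta> y (f y)" by (simp add: min_set_def)
  with y show ?R using min_set_iff by blast
next
  assume ?R
  then obtain y where y: "y \<in> min_set Y \<delta> f" "0 < \<delta> y (f y)" using min_set_iff by blast
  then show "hyperbolic Y \<delta> f" by (auto simp: hyperbolic_def min_set_def)
qed

end

end

section \<open>Midpoints in Busemann spaces\<close>

text \<open>Stated through distances alone, so that an isometry of a subspace transports midpoints
  without reference to geodesics of the whole space.\<close>

definition (in Metric_space) is_midpoint :: "'a \<Rightarrow> 'a \<Rightarrow> 'a \<Rightarrow> bool" where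
  "is_midpoint x y m \<longleftrightarrow> m \<in> M \<and> 2 * d x m = d x y \<and> 2 * d m y = d x y"

lemma (in geodesic_space) geodesic_from_zero:
  assumes "x \<in> M" "y \<in> M"
  shows "\<exists>c. geodesic_on M d {0..d x y} c \<and> c 0 = x \<and> c (d x y) = y"
proof -
  obtain a b \<gamma> where ab: "a \<le> b" and \<gamma>: "geodesic_on M d {a..b} \<gamma>" "\<gamma> a = x" "\<gamma> b = y"
    using geodesic_exists[OF assms] by blast
  have len: "d x y = b - a"
  proof -
    have "d (\<gamma> a) (\<gamma> b) = \<bar>b - a\<bar>" using \<gamma>(1) ab by (simp add: geodesic_on_def)
    with \<gamma> ab show ?thesis by simp
  qed
  have "geodesic_on M d {0..d x y} (\<lambda>t. \<gamma> (a + t))"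
    using \<gamma>(1) len unfolding geodesic_on_def by (auto simp: is_interval_cc)
  moreover have "\<gamma> (a + 0) = x" "\<gamma> (a + d x y) = y" using \<gamma> len by auto
  ultimately show ?thesis by blast
qed

context busemann_space
begin

lemma midpoint_exists:
  assumes "x \<in> M" "y \<in> M"
  shows "\<exists>m. is_midpoint x y m"
proof -
  obtain c where c: "geodesic_on M d {0..d x y} c" "c 0 = x" "c (d x y) = y"
    using geodesic_from_zero[OF assms] by blast
  have D: "d (c s) (c t) = \<bar>t - s\<bar>" if "s \<in> {0..d x y}" "t \<in> {0..d x y}" for s t
    using c(1) that by (simp add: geodesic_on_def)
  have "c (d x y / 2) \<in> M" using c(1) by (auto simp: geodesic_on_def)
  with D[of 0 "d x y / 2"] D[of "d x y / 2" "d x y"] c show ?thesis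
    unfolding is_midpoint_def by (intro exI[of _ "c (d x y / 2)"]) auto
qed

text \<open>Two geodesics joined at a metric midpoint form a geodesic, which makes the Busemann
  condition applicable to arbitrary midpoints. The endpoints are distinct because
  \<open>reparam_geodesic01\<close> demands positive speed.\<close>

lemma geodesic_through_midpoint:
  assumes x: "x \<in> M" and y: "y \<in> M" and xy: "x \<noteq> y" and m: "is_midpoint x y m"
  shows "\<exists>\<gamma>. reparam_geodesic01 M d \<gamma> \<and> \<gamma> 0 = x \<and> \<gamma> (1/2) = m \<and> \<gamma> 1 = y"
proof -
  define a where "a = d x m"
  have mM: "m \<in> M" and dxm: "d x m = a" and dmy: "d m y = a" and dxy: "d x y = 2 * a"
    using m by (auto simp: is_midpoint_def a_def)
  have a0: "0 < a" using dxy xy x y by (metis mdist_pos_less mult_pos_pos zero_less_mult_pos zero_less_numeral)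
  obtain c1 where c1: "geodesic_on M d {0..a} c1" "c1 0 = x" "c1 a = m"
    using geodesic_from_zero[OF x mM] dxm by metis
  obtain c2 where c2: "geodesic_on M d {0..a} c2" "c2 0 = m" "c2 a = y"
    using geodesic_from_zero[OF mM y] dmy by metis
  have D1: "d (c1 s) (c1 t) = \<bar>t - s\<bar>" if "s \<in> {0..a}" "t \<in> {0..a}" for s t
    using c1(1) that by (simp add: geodesic_on_def)
  have D2: "d (c2 s) (c2 t) = \<bar>t - s\<bar>" if "s \<in> {0..a}" "t \<in> {0..a}" for s t
    using c2(1) that by (simp add: geodesic_on_def)
  have M1: "c1 s \<in> M" if "s \<in> {0..a}" for s using c1(1) that by (auto simp: geodesic_on_def)
  have M2: "c2 s \<in> M" if "s \<in> {0..a}" for s using c2(1) that by (auto simp: geodesic_on_def)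
  define c where "c = (\<lambda>t. if t \<le> a then c1 t else c2 (t - a))"
  \<comment> \<open>The upper bound goes through \<open>m\<close>; the lower bound holds because the
    detour from \<open>x\<close> to \<open>y\<close> through both points has length at least
    \<open>2 * a\<close>.\<close>
  have cross: "d (c1 s) (c2 t) = a - s + t" if st: "s \<in> {0..a}" "t \<in> {0..a}" for s t
  proof (rule antisym)
    have "d (c1 s) (c2 t) \<le> d (c1 s) m + d m (c2 t)"
      using triangle[OF M1[OF st(1)] mM M2[OF st(2)]] .
    then show "d (c1 s) (c2 t) \<le> a - s + t"
      using D1[OF st(1), of a] D2[OF _ st(2), of 0] c1 c2 st a0 by auto
    have "d x y \<le> d x (c1 s) + (d (c1 s) (c2 t) + d (c2 t) y)"
      using triangle[OF x M1[OF st(1)] y] triangle[OF M1[OF st(1)] M2[OF st(2)] y] by linarith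
    moreover have "d x (c1 s) = s" using D1[OF _ st(1), of 0] c1 st a0 by auto
    moreover have "d (c2 t) y = a - t" using D2[OF st(2), of a] c2 st a0 by auto
    ultimately show "a - s + t \<le> d (c1 s) (c2 t)" using dxy by linarith
  qed
  have "d (c s) (c t) = \<bar>t - s\<bar>" if st: "s \<in> {0..2*a}" "t \<in> {0..2*a}" for s t
  proof -
    consider "s \<le> a" "t \<le> a" | "s \<le> a" "a < t" | "a < s" "t \<le> a" | "a < s" "a < t" by linarith
    then show ?thesis
    proof cases
      case 1
      then show ?thesis using D1[of s t] st by (simp add: c_def)
    next
      case 2
      then show ?thesis using cross[of s "t - a"] st by (simp add: c_def)
    next
      case 3
      then show ?thesis using cross[of t "s - a"] st
        by (simp add: c_def commute[of "c2 (s - a)" "c1 t"])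
    next
      case 4
      then show ?thesis using D2[of "s - a" "t - a"] st by (simp add: c_def)
    qed
  qed
  moreover have "c ` {0..2*a} \<subseteq> M" using M1 M2 by (auto simp: c_def)
  ultimately have "geodesic_on M d {0..2*a} c"
    by (simp add: geodesic_on_def is_interval_cc)
  then have "reparam_geodesic01 M d (\<lambda>t. c (2 * a * t))"
    unfolding reparam_geodesic01_def using a0
    by (intro exI[of _ "{0..2*a}"] exI[of _ c] exI[of _ "2*a"]) (auto simp: mult_left_le)
  moreover have "c (2 * a * 0) = x" "c (2 * a * (1/2)) = m" "c (2 * a * 1) = y"
    using c1 c2 a0 by (auto simp: c_def)
  ultimately show ?thesis by (intro exI[of _ "\<lambda>t. c (2 * a * t)"]) simp
qed

lemma midpoint_same:
  assumes "x \<in> M" "is_midpoint x x m"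
  shows "m = x"
proof -
  have "m \<in> M" and "2 * d x m = d x x" using assms(2) by (simp_all add: is_midpoint_def)
  then show ?thesis using zero[of x x] zero[of x m] assms(1) by simp
qed

lemma midpoint_convex_nondegenerate:
  assumes "x \<in> M" "y \<in> M" "x' \<in> M" "y' \<in> M" "x \<noteq> y" "x' \<noteq> y'"
    and "is_midpoint x y m" "is_midpoint x' y' m'"
  shows "2 * d m m' \<le> d x x' + d y y'"
proof -
  obtain \<gamma> where \<gamma>: "reparam_geodesic01 M d \<gamma>" "\<gamma> 0 = x" "\<gamma> (1/2) = m" "\<gamma> 1 = y"
    using geodesic_through_midpoint[OF assms(1,2,5,7)] by blast
  obtain \<eta> where \<eta>: "reparam_geodesic01 M d \<eta>" "\<eta> 0 = x'" "\<eta> (1/2) = m'" "\<eta> 1 = y'"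
    using geodesic_through_midpoint[OF assms(3,4,6,8)] by blast
  have "convex_on {0..1} (\<lambda>t. d (\<gamma> t) (\<eta> t))" using busemann_convex \<gamma> \<eta> by blast
  from convex_onD[OF this, of "1/2" 0 1] show ?thesis using \<gamma> \<eta> by simp
qed

text \<open>A constant map has no positive speed, so the geodesic from \<open>x\<close> to
  \<open>p\<close> is compared with the one from \<open>x\<close> to \<open>y\<close>: their
  midpoints \<open>n\<close> and \<open>m\<close> are at most half of \<open>d p y\<close> apart,
  and \<open>n\<close> is half of \<open>d p x\<close> away from \<open>p\<close>.\<close>

lemma midpoint_convex_point:
  assumes p: "p \<in> M" and x: "x \<in> M" and y: "y \<in> M" and m: "is_midpoint x y m"
  shows "2 * d p m \<le> d p x + d p y"
proof (cases "x = y \<or> x = p")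
  case True
  have mM: "m \<in> M" using m by (simp add: is_midpoint_def)
  show ?thesis
  proof (cases "x = p")
    case True
    then show ?thesis using m x by (simp add: is_midpoint_def)
  next
    case False
    with True have "x = y" by simp
    then have "m = x" using m x midpoint_same by blast
    with \<open>x = y\<close> show ?thesis by simp
  qed
next
  case False
  obtain n where n: "is_midpoint x p n" using midpoint_exists x p by blast
  have M: "m \<in> M" "n \<in> M" using m n by (auto simp: is_midpoint_def)
  have "2 * d n m \<le> d x x + d p y"
    using midpoint_convex_nondegenerate[OF x p x y _ _ n m] False by auto
  moreover have "d p m \<le> d p n + d n m" using triangle p M by blast
  moreover have "2 * d p n = d p x" using n by (simp add: is_midpoint_def commute)
  ultimately show ?thesis using x by simp
qed

text \<open>Degenerate pairs are covered by \<open>midpoint_convex_point\<close>. Busemann convexity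
  enters everything below only through these two lemmas.\<close>

lemma midpoint_convex:
  assumes "x \<in> M" "y \<in> M" "x' \<in> M" "y' \<in> M" and m: "is_midpoint x y m" and m': "is_midpoint x' y' m'"
  shows "2 * d m m' \<le> d x x' + d y y'"
proof -
  have M: "m \<in> M" "m' \<in> M" using m m' by (auto simp: is_midpoint_def)
  consider "x = y" | "x' = y'" | "x \<noteq> y" "x' \<noteq> y'" by blast
  then show ?thesis
  proof cases
    case 1
    then have "m = x" using m assms(1) midpoint_same by blast
    with 1 show ?thesis using midpoint_convex_point[OF assms(1,3,4) m'] by simp
  next
    case 2
    then have "m' = x'" using m' assms(3) midpoint_same by blast
    with 2 show ?thesis using midpoint_convex_point[OF assms(3,1,2) m] by (simp add: commute)
  next
    case 3
    then show ?thesis using midpoint_convex_nondegenerate assms by blast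
  qed
qed

lemma midpoint_unique:
  assumes "x \<in> M" "y \<in> M" "is_midpoint x y m" "is_midpoint x y m'"
  shows "m = m'"
proof -
  have "2 * d m m' \<le> 0" using midpoint_convex[OF assms(1,2,1,2,3,4)] assms(1,2) by simp
  then have "d m m' = 0" using nonneg[of m m'] by linarith
  then show ?thesis using zero assms by (auto simp: is_midpoint_def)
qed

text \<open>The triangle inequality turns both upper bounds into equalities.\<close>

lemma is_midpointI:
  assumes "x \<in> M" "y \<in> M" "m \<in> M" "2 * d x m \<le> d x y" "2 * d m y \<le> d x y"
  shows "is_midpoint x y m"
  using assms triangle[of x m y] by (auto simp: is_midpoint_def)

end

section \<open>Lines parallel to a given line\<close>

lemma (in Metric_space) parallel_iff: "parallel d \<gamma> \<eta> \<longleftrightarrow> (\<exists>B. \<forall>t. d (\<gamma> t) (\<eta> t) \<le> B)"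
  by (simp add: parallel_def bounded_iff)

locale parallel_family = busemann_space M d
  for M :: "'a set" and d :: "'a \<Rightarrow> 'a \<Rightarrow> real" +
  fixes \<omega> :: "real \<Rightarrow> 'a"
  assumes line: "geodesic_line M d \<omega>"
begin

abbreviation "P \<equiv> parallel_geodesics M d \<omega>"
abbreviation "Y \<equiv> parallel_set M d \<omega>"
abbreviation "Ls \<equiv> parallel_lines M d \<omega>"
abbreviation "dH \<equiv> hausdorff_dist d"

lemma line_closed: "\<gamma> \<in> P \<Longrightarrow> \<gamma> t \<in> M"
  by (auto simp: parallel_geodesics_def geodesic_on_def)

lemma line_dist: "\<gamma> \<in> P \<Longrightarrow> d (\<gamma> s) (\<gamma> t) = \<bar>t - s\<bar>"
  by (auto simp: parallel_geodesics_def geodesic_on_def)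

lemma parallel_bounded:
  assumes "\<gamma> \<in> P" "\<eta> \<in> P"
  shows "\<exists>B. \<forall>t. d (\<gamma> t) (\<eta> t) \<le> B"
proof -
  obtain B C where B: "\<And>t. d (\<gamma> t) (\<omega> t) \<le> B" and C: "\<And>t. d (\<eta> t) (\<omega> t) \<le> C"
    using assms unfolding parallel_geodesics_def parallel_iff by blast
  have "d (\<gamma> t) (\<eta> t) \<le> B + C" for t
  proof -
    have "\<omega> t \<in> M" using line by (auto simp: geodesic_on_def)
    then show ?thesis
      using triangle[of "\<gamma> t" "\<omega> t" "\<eta> t"] B[of t] C[of t] line_closed[OF assms(1)]
        line_closed[OF assms(2)] commute[of "\<omega> t" "\<eta> t"] by fastforce
  qed
  then show ?thesis by blast
qed

lemma parallel_geodesicsI: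
  assumes \<gamma>: "\<And>s t. d (\<gamma> s) (\<gamma> t) = \<bar>t - s\<bar>" "\<And>t. \<gamma> t \<in> M"
    and \<eta>: "\<eta> \<in> P" and B: "\<And>t. d (\<gamma> t) (\<eta> t) \<le> B"
  shows "\<gamma> \<in> P"
proof -
  obtain C where C: "\<And>t. d (\<eta> t) (\<omega> t) \<le> C"
    using \<eta> unfolding parallel_geodesics_def parallel_iff by blast
  have "d (\<gamma> t) (\<omega> t) \<le> B + C" for t
    using triangle[of "\<gamma> t" "\<eta> t" "\<omega> t"] B[of t] C[of t] line line_closed[OF \<eta>] \<gamma>
    by (fastforce simp: geodesic_on_def)
  then show ?thesis using \<gamma> by (auto simp: parallel_geodesics_def parallel_iff geodesic_on_def)
qed

lemma line_shift: "\<gamma> \<in> P \<Longrightarrow> (\<lambda>t. \<gamma> (t + c)) \<in> P"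
  by (rule parallel_geodesicsI[where \<eta> = \<gamma> and B = "\<bar>c\<bar>"])
     (auto simp: line_dist line_closed)

lemma is_midpoint_line: "\<gamma> \<in> P \<Longrightarrow> is_midpoint (\<gamma> s) (\<gamma> t) (\<gamma> ((s + t) / 2))"
  by (auto simp: is_midpoint_def line_dist line_closed abs_if field_simps)

text \<open>As a function of \<open>v\<close> the distance is midpoint-convex, and it is bounded
  because shifted lines remain parallel; hence it is constant.\<close>

lemma parallel_dist:
  assumes \<gamma>: "\<gamma> \<in> P" and \<eta>: "\<eta> \<in> P"
  shows "d (\<gamma> (s + v)) (\<eta> (t + v)) = d (\<gamma> s) (\<eta> t)"
proof -
  define f where "f = (\<lambda>v. d (\<gamma> (s + v)) (\<eta> (t + v)))"
  obtain B where B: "\<And>v. f v \<le> B"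
    using parallel_bounded[OF line_shift[OF \<gamma>, of s] line_shift[OF \<eta>, of t]]
    by (auto simp: f_def add.commute)
  have "2 * f ((v + w) / 2) \<le> f v + f w" for v w
  proof -
    have eq: "((r + v) + (r + w)) / 2 = r + (v + w) / 2" for r :: real by (simp add: field_simps)
    show ?thesis
      using midpoint_convex[OF line_closed[OF \<gamma>] line_closed[OF \<gamma>] line_closed[OF \<eta>] line_closed[OF \<eta>]
          is_midpoint_line[OF \<gamma>, of "s + v" "s + w"] is_midpoint_line[OF \<eta>, of "t + v" "t + w"]]
      by (simp only: f_def eq)
  qed
  then have "f v = f 0" using midpoint_convex_bounded_const[of f B v 0] B by blast
  then show ?thesis by (simp add: f_def)
qed

lemma lines_meet:
  assumes "\<gamma> \<in> P" "\<eta> \<in> P" "\<gamma> s = \<eta> t"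
  shows "\<gamma> (s + v) = \<eta> (t + v)"
proof -
  have "d (\<gamma> (s + v)) (\<eta> (t + v)) = 0"
    using parallel_dist[OF assms(1,2)] assms(3) line_closed[OF assms(2)] by simp
  then show ?thesis using zero line_closed assms by blast
qed

text \<open>Parallel lines that meet agree up to a shift of the parameter, so the lines partition
  \<open>X\<^sub>\<omega>\<close>.\<close>

lemma range_eq_of_meet:
  assumes "\<gamma> \<in> P" "\<eta> \<in> P" "\<gamma> s = \<eta> t"
  shows "range \<gamma> = range \<eta>"
proof -
  have "\<gamma> r = \<eta> (t + (r - s))" "\<eta> r = \<gamma> (s + (r - t))" for r
    using lines_meet[OF assms, of "r - s"] lines_meet[OF assms, of "r - t"] by simp_all
  then show ?thesis by (metis (no_types, lifting) image_subset_iff rangeI subset_antisym)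
qed

lemma line_through:
  assumes "x \<in> Y"
  shows "\<exists>\<gamma>\<in>P. \<gamma> 0 = x"
proof -
  obtain \<gamma> t where "\<gamma> \<in> P" "x = \<gamma> t" using assms by (auto simp: parallel_set_def)
  then show ?thesis using line_shift[of \<gamma> t] by (intro bexI[of _ "\<lambda>s. \<gamma> (s + t)"]) auto
qed

lemma line_in_Y: "\<gamma> \<in> P \<Longrightarrow> \<gamma> t \<in> Y"
  by (auto simp: parallel_set_def)

lemma Y_subset_M: "x \<in> Y \<Longrightarrow> x \<in> M"
  using line_closed by (auto simp: parallel_set_def)

text \<open>Makes the distance from a fixed point of one line to \<open>\<eta> t\<close> a proper
  function of \<open>t\<close>. This stops linear growth in \<open>midline\<close>, confines minima
  to a compact interval, and later excludes nonzero periods.\<close>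

lemma dist_ge_parameter:
  assumes \<gamma>: "\<gamma> \<in> P" and \<eta>: "\<eta> \<in> P"
  shows "\<bar>t\<bar> - d (\<gamma> 0) (\<eta> 0) \<le> d (\<gamma> 0) (\<eta> t)"
  using triangle[of "\<eta> 0" "\<gamma> 0" "\<eta> t"] line_closed[OF \<gamma>] line_closed[OF \<eta>]
    line_dist[OF \<eta>, of 0 t] commute[of "\<gamma> 0" "\<eta> 0"] by simp

text \<open>
  Both triangles cut off by the diagonal have a parallel side of the strip as a side, so the
  midpoint of \<open>\<gamma> (a - v)\<close> and \<open>\<eta> (b + v)\<close> is at most half of \<open>d (\<gamma> a) (\<eta> b)\<close> away from both
  \<open>\<gamma> a\<close> and \<open>\<eta> b\<close>.
\<close>

lemma midpoint_diagonal:
  assumes \<gamma>: "\<gamma> \<in> P" and \<eta>: "\<eta> \<in> P" and m: "is_midpoint (\<gamma> (a - v)) (\<eta> (b + v)) m"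
  shows "is_midpoint (\<gamma> a) (\<eta> b) m"
proof (rule is_midpointI)
  show "m \<in> M" using m by (simp add: is_midpoint_def)
  note cl = line_closed[OF \<gamma>] line_closed[OF \<eta>]
  have "2 * d (\<gamma> a) m \<le> d (\<gamma> (a - v)) (\<gamma> (a - v)) + d (\<gamma> (a + v)) (\<eta> (b + v))"
    using midpoint_convex[OF cl(1) cl(1) cl(1) cl(2) _ m] is_midpoint_line[OF \<gamma>, of "a - v" "a + v"]
    by simp
  then show "2 * d (\<gamma> a) m \<le> d (\<gamma> a) (\<eta> b)"
    using parallel_dist[OF \<gamma> \<eta>, of a v b] cl by simp
  have "2 * d m (\<eta> b) \<le> d (\<gamma> (a - v)) (\<eta> (b - v)) + d (\<eta> (b + v)) (\<eta> (b + v))"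
    using midpoint_convex[OF cl(1) cl(2) cl(2) cl(2) m] is_midpoint_line[OF \<eta>, of "b - v" "b + v"]
    by simp
  then show "2 * d m (\<eta> b) \<le> d (\<gamma> a) (\<eta> b)"
    using parallel_dist[OF \<gamma> \<eta>, of a "-v" b] cl by simp
qed (auto simp: line_closed assms)

text \<open>
  That the midline \<open>\<mu>\<close> does not contract distances is the delicate point: \<open>\<mu> t\<close> and \<open>\<mu> (t + u)\<close> are
  also midpoints between a point far back on \<open>\<gamma>\<close> and points of \<open>\<eta>\<close> at mutual distance \<open>2 * u\<close>, and the
  triangle inequalities so obtained are telescoped.
\<close>

lemma midline:
  assumes \<gamma>: "\<gamma> \<in> P" and \<eta>: "\<eta> \<in> P"
  shows "\<exists>\<mu>\<in>P. \<forall>a b. is_midpoint (\<gamma> a) (\<eta> b) (\<mu> ((a + b) / 2))"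
proof -
  note cl = line_closed[OF \<gamma>] line_closed[OF \<eta>]
  obtain \<mu> where \<mu>: "\<And>t. is_midpoint (\<gamma> t) (\<eta> t) (\<mu> t)"
  proof -
    have "\<forall>t. \<exists>m. is_midpoint (\<gamma> t) (\<eta> t) m" using midpoint_exists[OF cl] by blast
    from choice[OF this] show ?thesis using that by blast
  qed
  \<comment> \<open>Sliding along the diagonal by \<open>(a - b) / 2\<close> brings both parameters
    to their mean, where \<open>\<mu>\<close> is a midpoint by choice.\<close>
  have mid: "is_midpoint (\<gamma> a) (\<eta> b) (\<mu> ((a + b) / 2))" for a b
    using midpoint_diagonal[OF \<gamma> \<eta>, of a "(a - b) / 2" b "\<mu> ((a + b) / 2)"] \<mu>[of "(a + b) / 2"]
    by (simp add: field_simps)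
  have \<mu>M: "\<mu> t \<in> M" for t using \<mu> by (simp add: is_midpoint_def)
  have le: "d (\<mu> s) (\<mu> t) \<le> \<bar>t - s\<bar>" for s t
    using midpoint_convex[OF cl cl \<mu> \<mu>, of s t] line_dist \<gamma> \<eta> by simp
  define F where "F = (\<lambda>t. d (\<gamma> 0) (\<eta> t))"
  have ge: "u \<le> d (\<mu> t) (\<mu> (t + u))" if u: "0 \<le> u" for t u
  proof -
    define D where "D = d (\<mu> t) (\<mu> (t + u))"
    have step: "F (2 * u * real (Suc n)) - F (2 * u * real n) \<le> 2 * D" for n
    proof -
      \<comment> \<open>Chosen so that the points of \<open>\<eta>\<close> with parameters
        \<open>a + 2 * u * n\<close> and \<open>a + 2 * u * (n + 1)\<close> have
        \<open>\<mu> t\<close> and \<open>\<mu> (t + u)\<close> as midpoints with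
        \<open>\<gamma> a\<close>.\<close>
      define a where "a = t - u * real n"
      have eq: "(a + (a + 2 * u * real k)) / 2 = t + u * (real k - real n)" for k
        by (simp add: a_def field_simps)
      have t: "t + u * (real (Suc n) - real n) = t + u" by simp
      have "2 * d (\<gamma> a) (\<mu> t) = d (\<gamma> a) (\<eta> (a + 2 * u * real n))"
        using mid[of a "a + 2 * u * real n"] eq[of n] by (simp add: is_midpoint_def)
      moreover have "2 * d (\<gamma> a) (\<mu> (t + u)) = d (\<gamma> a) (\<eta> (a + 2 * u * real (Suc n)))"
        using mid[of a "a + 2 * u * real (Suc n)"] eq[of "Suc n"] t by (simp only: is_midpoint_def)
      moreover have "d (\<gamma> a) (\<eta> (a + r)) = F r" for r
        using parallel_dist[OF \<gamma> \<eta>, of 0 a r] by (simp add: F_def add.commute)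
      moreover have "d (\<gamma> a) (\<mu> (t + u)) \<le> d (\<gamma> a) (\<mu> t) + D"
        unfolding D_def using triangle cl \<mu>M by blast
      ultimately show ?thesis by simp
    qed
    have sum: "F (2 * u * real n) - F 0 \<le> real n * (2 * D)" for n
    proof (induction n)
      case (Suc n)
      with step[of n] show ?case by (simp add: algebra_simps)
    qed simp
    \<comment> \<open>\<open>F\<close> is at least its parameter minus \<open>F 0\<close>, while the
      telescoped sum lets it grow by at most \<open>2 * D\<close> per step of
      \<open>2 * u\<close>.\<close>
    have "real n * (u - D) \<le> F 0" for n
      using sum[of n] dist_ge_parameter[OF \<gamma> \<eta>, of "2 * u * real n"] u
      by (simp add: F_def algebra_simps)
    then have "\<not> 0 < u - D" using ex_less_of_nat_mult[of "u - D" "F 0"] by (meson not_less)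
    then show ?thesis by (simp add: D_def)
  qed
  have dist: "d (\<mu> s) (\<mu> t) = \<bar>t - s\<bar>" for s t
  proof (cases "s \<le> t")
    case True
    then show ?thesis using ge[of "t - s" s] le[of s t] by simp
  next
    case False
    then show ?thesis using ge[of "s - t" t] le[of t s] commute[of "\<mu> s" "\<mu> t"] by simp
  qed
  have "d (\<mu> t) (\<gamma> t) \<le> F 0" for t
  proof -
    have "2 * d (\<gamma> t) (\<mu> t) = F 0"
      using \<mu>[of t] parallel_dist[OF \<gamma> \<eta>, of 0 t 0] by (simp add: is_midpoint_def F_def)
    then show ?thesis using commute[of "\<mu> t" "\<gamma> t"] nonneg[of "\<gamma> t" "\<mu> t"] by linarith
  qed
  then have "\<mu> \<in> P" using parallel_geodesicsI[OF dist \<mu>M \<gamma>] by blast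
  with mid show ?thesis by blast
qed

text \<open>Uniqueness of midpoints makes \<open>\<mu>\<close> meet the midline, so both agree up to
  the shift \<open>c - (a + b) / 2\<close>.\<close>

lemma midline_of_midpoint:
  assumes \<gamma>: "\<gamma> \<in> P" and \<eta>: "\<eta> \<in> P" and \<mu>: "\<mu> \<in> P"
    and m: "is_midpoint (\<gamma> a) (\<eta> b) (\<mu> c)"
  shows "is_midpoint (\<gamma> s) (\<eta> t) (\<mu> (c - (a + b) / 2 + (s + t) / 2))"
proof -
  obtain \<nu> where \<nu>: "\<nu> \<in> P" "\<And>a b. is_midpoint (\<gamma> a) (\<eta> b) (\<nu> ((a + b) / 2))"
    using midline[OF \<gamma> \<eta>] by blast
  have "\<mu> c = \<nu> ((a + b) / 2)"
    using midpoint_unique[OF line_closed[OF \<gamma>] line_closed[OF \<eta>] m \<nu>(2)] .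
  from lines_meet[OF \<mu> \<nu>(1) this, of "(s + t) / 2 - (a + b) / 2"] \<nu>(2)[of s t]
  show ?thesis by (simp add: algebra_simps)
qed

text \<open>An isometry of \<open>X\<^sub>\<omega>\<close> is constrained only there, so midpoints
  must stay inside before it can be applied to them.\<close>

lemma midpoint_in_Y:
  assumes "x \<in> Y" "y \<in> Y" "is_midpoint x y m"
  shows "m \<in> Y"
proof -
  obtain \<gamma> \<eta> where \<gamma>: "\<gamma> \<in> P" "\<gamma> 0 = x" and \<eta>: "\<eta> \<in> P" "\<eta> 0 = y"
    using line_through assms by meson
  obtain \<nu> where \<nu>: "\<nu> \<in> P" "\<And>a b. is_midpoint (\<gamma> a) (\<eta> b) (\<nu> ((a + b) / 2))"
    using midline[OF \<gamma>(1) \<eta>(1)] by blast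
  have "m = \<nu> ((0 + 0) / 2)"
    using midpoint_unique[OF _ _ assms(3)] \<nu>(2)[of 0 0] \<gamma> \<eta> assms Y_subset_M by blast
  then show ?thesis using line_in_Y[OF \<nu>(1)] by simp
qed

section \<open>The Hausdorff metric on parallel lines\<close>

text \<open>A continuous function attains its minimum on a compact interval, outside of which it is
  at least \<open>F 0\<close>; by \<open>parallel_dist\<close> the offset \<open>r\<close> is the
  same for every \<open>s\<close>.\<close>

lemma nearest_parameter:
  assumes \<gamma>: "\<gamma> \<in> P" and \<eta>: "\<eta> \<in> P"
  shows "\<exists>r. \<forall>s t. d (\<gamma> s) (\<eta> (s + r)) \<le> d (\<gamma> s) (\<eta> t)"
proof -
  define F where "F = (\<lambda>t. d (\<gamma> 0) (\<eta> t))"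
  note cl = line_closed[OF \<gamma>] line_closed[OF \<eta>]
  have lip: "F s \<le> F t + \<bar>s - t\<bar>" for s t
    using triangle[of "\<gamma> 0" "\<eta> t" "\<eta> s"] cl line_dist[OF \<eta>, of t s] by (simp add: F_def)
  have "\<bar>F s - F t\<bar> \<le> \<bar>s - t\<bar>" for s t
    using lip[of s t] lip[of t s] by (simp add: abs_le_iff)
  then have "1-lipschitz_on UNIV F" by (intro lipschitz_onI) (auto simp: dist_real_def)
  then have cont: "continuous_on {- (2 * F 0)..2 * F 0} F"
    by (meson continuous_on_subset lipschitz_on_continuous_on subset_UNIV)
  have F0: "0 \<le> F 0" by (simp add: F_def)
  then obtain r where r: "\<And>t. t \<in> {- (2 * F 0)..2 * F 0} \<Longrightarrow> F r \<le> F t"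
    using continuous_attains_inf[OF compact_Icc _ cont] by fastforce
  have min: "F r \<le> F t" for t
  proof (cases "t \<in> {- (2 * F 0)..2 * F 0}")
    case False
    then have "2 * F 0 \<le> \<bar>t\<bar>" by auto
    then have "F 0 \<le> F t" using dist_ge_parameter[OF \<gamma> \<eta>, of t] by (simp add: F_def)
    with r[of 0] F0 show ?thesis by auto
  qed (use r in blast)
  have "d (\<gamma> s) (\<eta> (s + t)) = F t" for s t
    using parallel_dist[OF \<gamma> \<eta>, of 0 s t] by (simp add: F_def add.commute)
  from this[of _ "_ - _"] this[of _ r] min show ?thesis
    by (intro exI[of _ r] allI) (metis add_diff_cancel_left' add.commute diff_add_cancel)
qed

text \<open>All inner infima are attained and equal the same constant, so both suprema run over
  constant families.\<close>

lemma hausdorff_dist_lines: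
  assumes \<gamma>: "\<gamma> \<in> P" and \<eta>: "\<eta> \<in> P"
    and r: "\<And>s t. d (\<gamma> s) (\<eta> (s + r)) \<le> d (\<gamma> s) (\<eta> t)"
  shows "dH (range \<gamma>) (range \<eta>) = d (\<gamma> s) (\<eta> (s + r))"
proof -
  define m where "m = d (\<gamma> 0) (\<eta> r)"
  have m: "d (\<gamma> s) (\<eta> (s + r)) = m" for s
    using parallel_dist[OF \<gamma> \<eta>, of 0 s r] by (simp add: m_def add.commute)
  have ge: "m \<le> d (\<gamma> s) (\<eta> t)" for s t using r[of s t] by (simp add: m)
  have "(INF b\<in>range \<eta>. d (\<gamma> s) b) = m" for s
    by (rule cInf_eq_minimum) (use m[of s] ge in \<open>auto intro!: image_eqI[of _ _ "\<eta> (s + r)"]\<close>)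
  then have 1: "(SUP a\<in>range \<gamma>. INF b\<in>range \<eta>. d a b) = m" by (simp add: image_image)
  have "(INF a\<in>range \<gamma>. d a (\<eta> t)) = m" for t
    by (rule cInf_eq_minimum) (use m[of "t - r"] ge in \<open>auto intro!: image_eqI[of _ _ "\<gamma> (t - r)"]\<close>)
  then have 2: "(SUP b\<in>range \<eta>. INF a\<in>range \<gamma>. d a b) = m" by (simp add: image_image)
  show ?thesis unfolding hausdorff_dist_def 1 2 m by simp
qed

text \<open>Together with \<open>hausdorff_dist_attained\<close> this describes \<open>dH\<close> as
  the least distance between points of the two lines, realised from every point of either line; its
  definition is not unfolded again.\<close>

lemma hausdorff_dist_le:
  assumes "A \<in> Ls" "B \<in> Ls" "x \<in> A" "y \<in> B"
  shows "dH A B \<le> d x y"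
proof -
  obtain \<gamma> \<eta> s t where \<gamma>: "\<gamma> \<in> P" "A = range \<gamma>" "x = \<gamma> s" and \<eta>: "\<eta> \<in> P" "B = range \<eta>" "y = \<eta> t"
    using assms by (auto simp: parallel_lines_def)
  obtain r where "\<And>s t. d (\<gamma> s) (\<eta> (s + r)) \<le> d (\<gamma> s) (\<eta> t)"
    using nearest_parameter[OF \<gamma>(1) \<eta>(1)] by blast
  with hausdorff_dist_lines[OF \<gamma>(1) \<eta>(1) this, of s] \<gamma> \<eta> show ?thesis by simp
qed

lemma hausdorff_dist_attained:
  assumes "A \<in> Ls" "B \<in> Ls"
  shows hausdorff_dist_attained_right: "x \<in> A \<Longrightarrow> \<exists>y\<in>B. d x y = dH A B"
    and hausdorff_dist_attained_left: "y \<in> B \<Longrightarrow> \<exists>x\<in>A. d x y = dH A B"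
proof -
  obtain \<gamma> \<eta> where \<gamma>: "\<gamma> \<in> P" "A = range \<gamma>" and \<eta>: "\<eta> \<in> P" "B = range \<eta>"
    using assms by (auto simp: parallel_lines_def)
  obtain r where r: "\<And>s t. d (\<gamma> s) (\<eta> (s + r)) \<le> d (\<gamma> s) (\<eta> t)"
    using nearest_parameter[OF \<gamma>(1) \<eta>(1)] by blast
  note eq = hausdorff_dist_lines[OF \<gamma>(1) \<eta>(1) r]
  show "\<exists>y\<in>B. d x y = dH A B" if x: "x \<in> A"
  proof -
    obtain s where "x = \<gamma> s" using x \<gamma> by blast
    with eq[of s] \<gamma> \<eta> show ?thesis by auto
  qed
  show "\<exists>x\<in>A. d x y = dH A B" if y: "y \<in> B"
  proof -
    obtain t where "y = \<eta> t" using y \<eta> by blast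
    with eq[of "t - r"] \<gamma> \<eta> show ?thesis by auto
  qed
qed

lemma line_exists: "A \<in> Ls \<Longrightarrow> \<exists>x. x \<in> A"
  by (auto simp: parallel_lines_def)

lemma Ls_subset_Y: "\<lbrakk>A \<in> Ls; x \<in> A\<rbrakk> \<Longrightarrow> x \<in> Y"
  by (auto simp: parallel_lines_def parallel_set_def)

lemma Ls_eq_of_meet: "\<lbrakk>A \<in> Ls; B \<in> Ls; x \<in> A; x \<in> B\<rbrakk> \<Longrightarrow> A = B"
  unfolding parallel_lines_def using range_eq_of_meet by blast

sublocale pts: carrier_metric Y d
  using Y_subset_M commute triangle by unfold_locales auto

sublocale lines: carrier_metric Ls dH
proof
  show nonneg: "0 \<le> dH A B" if "A \<in> Ls" "B \<in> Ls" for A B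
    using line_exists[OF that(1)] hausdorff_dist_attained_right[OF that] nonneg by metis
  show "dH A B = 0 \<longleftrightarrow> A = B" if AB: "A \<in> Ls" "B \<in> Ls" for A B
  proof
    assume "dH A B = 0"
    then obtain x y where "x \<in> A" "y \<in> B" "d x y = 0"
      using line_exists[OF AB(1)] hausdorff_dist_attained_right[OF AB] by metis
    then show "A = B" using Ls_eq_of_meet AB Ls_subset_Y pts.zero_on by metis
  next
    assume eq: "A = B"
    obtain x where x: "x \<in> A" using line_exists[OF AB(1)] by blast
    then have "d x x = 0" using pts.zero_on Ls_subset_Y AB by blast
    with x eq hausdorff_dist_le[OF AB x, of x] nonneg[OF AB] show "dH A B = 0" by auto
  qed
  show "dH A B = dH B A" if AB: "A \<in> Ls" "B \<in> Ls" for A B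
  proof -
    have "dH A B \<le> dH B A" if AB: "A \<in> Ls" "B \<in> Ls" for A B
    proof -
      obtain x y where "x \<in> A" "y \<in> B" "d y x = dH B A"
        using line_exists[OF AB(1)] hausdorff_dist_attained_left[OF AB(2,1)] by metis
      then show ?thesis using hausdorff_dist_le[OF AB] commute by metis
    qed
    with AB show ?thesis by (simp add: order_antisym)
  qed
  show "dH A C \<le> dH A B + dH B C" if ABC: "A \<in> Ls" "B \<in> Ls" "C \<in> Ls" for A B C
  proof -
    \<comment> \<open>Every point realises the distance to another line, so nearest points can be
      chained from \<open>A\<close> through \<open>B\<close> to \<open>C\<close>.\<close>
    obtain x y z where xyz: "x \<in> A" "y \<in> B" "z \<in> C" "d x y = dH A B" "d y z = dH B C"
      using line_exists[OF ABC(1)] hausdorff_dist_attained_right ABC by metis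
    then have "d x z \<le> d x y + d y z" using pts.triangle_on Ls_subset_Y ABC by blast
    with xyz hausdorff_dist_le[OF ABC(1,3), of x z] show ?thesis by simp
  qed
qed

text \<open>Taking midpoints with \<open>\<gamma> 0\<close> maps the line \<open>B\<close> onto the
  line \<open>C\<close> and halves the distance to \<open>\<gamma> 0\<close>, so the least distances
  are in the same ratio.\<close>

lemma hausdorff_dist_midline:
  assumes ABC: "A \<in> Ls" "B \<in> Ls" "C \<in> Ls" and xy: "x \<in> A" "y \<in> B" and m: "m \<in> C" "is_midpoint x y m"
  shows "dH A B = 2 * dH A C"
proof -
  obtain \<gamma> \<eta> \<mu> a b c where \<gamma>: "\<gamma> \<in> P" "A = range \<gamma>" "x = \<gamma> a"
    and \<eta>: "\<eta> \<in> P" "B = range \<eta>" "y = \<eta> b" and \<mu>: "\<mu> \<in> P" "C = range \<mu>" "m = \<mu> c"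
    using assms by (auto simp: parallel_lines_def)
  define e where "e = c - (a + b) / 2"
  have mid: "is_midpoint (\<gamma> s) (\<eta> t) (\<mu> (e + (s + t) / 2))" for s t
    using midline_of_midpoint[OF \<gamma>(1) \<eta>(1) \<mu>(1)] m(2) \<gamma> \<eta> \<mu> by (simp add: e_def)
  obtain t where t: "d (\<gamma> 0) (\<eta> t) = dH A B"
    using hausdorff_dist_attained_right[OF ABC(1,2), of "\<gamma> 0"] \<gamma> \<eta> by auto
  obtain u where u: "d (\<gamma> 0) (\<mu> u) = dH A C"
    using hausdorff_dist_attained_right[OF ABC(1,3), of "\<gamma> 0"] \<gamma> \<mu> by auto
  have "dH A C \<le> d (\<gamma> 0) (\<mu> (e + (0 + t) / 2))"
    using hausdorff_dist_le[OF ABC(1,3)] \<gamma> \<mu> by blast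
  with mid[of 0 t] t have 1: "2 * dH A C \<le> dH A B" by (simp add: is_midpoint_def)
  have "dH A B \<le> d (\<gamma> 0) (\<eta> (2 * (u - e)))"
    using hausdorff_dist_le[OF ABC(1,2)] \<gamma> \<eta> by blast
  moreover have "e + (0 + 2 * (u - e)) / 2 = u" by (simp add: field_simps)
  then have "is_midpoint (\<gamma> 0) (\<eta> (2 * (u - e))) (\<mu> u)" using mid[of 0 "2 * (u - e)"] by (simp only:)
  ultimately have "dH A B \<le> 2 * dH A C" using u by (simp add: is_midpoint_def)
  with 1 show ?thesis by linarith
qed

text \<open>The sign \<open>\<epsilon>\<close> treats both orientations at once. The images of
  \<open>\<gamma>\<close> and \<open>\<omega>\<close> stay at bounded distance, so the bound for
  \<open>\<omega>\<close> passes to every parallel line. The map \<open>h\<close> will be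
  \<open>g\<close> as well as its inverse.\<close>

lemma isometry_line:
  assumes h: "isometry_of Y d h" and \<epsilon>: "\<epsilon> = 1 \<or> \<epsilon> = -1"
    and B: "\<And>t. d (h (\<omega> (\<epsilon> * t))) (\<omega> t) \<le> B" and \<gamma>: "\<gamma> \<in> P"
  shows "(\<lambda>t. h (\<gamma> (\<epsilon> * t))) \<in> P"
proof -
  have \<omega>: "\<omega> \<in> P" using line by (auto simp: parallel_geodesics_def parallel_iff geodesic_on_def)
  obtain C where C: "\<And>t. d (\<gamma> t) (\<omega> t) \<le> C" using parallel_bounded[OF \<gamma> \<omega>] by blast
  show ?thesis
  proof (rule parallel_geodesicsI[OF _ _ \<omega>])
    show "d (h (\<gamma> (\<epsilon> * s))) (h (\<gamma> (\<epsilon> * t))) = \<bar>t - s\<bar>" for s t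
      using pts.isometry_dist[OF h line_in_Y[OF \<gamma>] line_in_Y[OF \<gamma>]] line_dist[OF \<gamma>] \<epsilon> by auto
    show "h (\<gamma> (\<epsilon> * t)) \<in> M" for t
      using pts.isometry_closed[OF h line_in_Y[OF \<gamma>]] Y_subset_M by blast
    show "d (h (\<gamma> (\<epsilon> * t))) (\<omega> t) \<le> C + B" for t
    proof -
      have "d (h (\<gamma> (\<epsilon> * t))) (\<omega> t) \<le> d (h (\<gamma> (\<epsilon> * t))) (h (\<omega> (\<epsilon> * t))) + d (h (\<omega> (\<epsilon> * t))) (\<omega> t)"
        using pts.triangle_on pts.isometry_closed[OF h] line_in_Y \<gamma> \<omega> by meson
      moreover have "d (h (\<gamma> (\<epsilon> * t))) (h (\<omega> (\<epsilon> * t))) \<le> C"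
        using pts.isometry_dist[OF h line_in_Y[OF \<gamma>] line_in_Y[OF \<omega>]] C by simp
      ultimately show ?thesis using B[of t] by linarith
    qed
  qed
qed

end

section \<open>Isometries preserving the foliation\<close>

locale foliation_isometry = parallel_family M d \<omega>
  for M :: "'a set" and d :: "'a \<Rightarrow> 'a \<Rightarrow> real" and \<omega> :: "real \<Rightarrow> 'a" +
  fixes g :: "'a \<Rightarrow> 'a"
  assumes iso: "isometry_of Y d g" and pres: "preserves_foliation d \<omega> g"
begin

abbreviation "g\<omega> \<equiv> \<lambda>L. g ` L"

lemmas g_closed = pts.isometry_closed[OF iso]
  and g_dist = pts.isometry_dist[OF iso]
  and gpow_closed = pts.funpow_closed[OF iso]

text \<open>The inverse of \<open>g\<close> shares the sign of \<open>g\<close> because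
  \<open>\<epsilon> * \<epsilon> = 1\<close>; it is needed for surjectivity on lines.\<close>

lemma orientation:
  obtains \<epsilon> :: real where "\<epsilon> = 1 \<or> \<epsilon> = -1"
    and "\<And>\<gamma>. \<gamma> \<in> P \<Longrightarrow> (\<lambda>t. g (\<gamma> (\<epsilon> * t))) \<in> P"
    and "\<And>\<gamma>. \<gamma> \<in> P \<Longrightarrow> (\<lambda>t. inv_into Y g (\<gamma> (\<epsilon> * t))) \<in> P"
proof -
  obtain \<epsilon> B where \<epsilon>: "\<epsilon> = 1 \<or> \<epsilon> = (-1 :: real)" and B: "\<And>t. d (g (\<omega> (\<epsilon> * t))) (\<omega> t) \<le> B"
  proof -
    obtain B where "(\<forall>t. d (g (\<omega> (1 * t))) (\<omega> t) \<le> B) \<or> (\<forall>t. d (g (\<omega> (-1 * t))) (\<omega> t) \<le> B)"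
      using pres by (auto simp: preserves_foliation_def parallel_iff reverse_line_def)
    then show ?thesis using that by blast
  qed
  have bij: "bij_betw g Y Y" using iso by (simp add: isometry_of_def)
  let ?h = "inv_into Y g"
  have gh: "g (?h x) = x" "?h x \<in> Y" if "x \<in> Y" for x
    using bij that by (auto simp: bij_betw_inv_into_right bij_betwE[OF bij_betw_inv_into])
  have h: "isometry_of Y d ?h"
    using bij_betw_inv_into[OF bij] gh g_dist unfolding isometry_of_def by metis
  have \<omega>Y: "\<omega> t \<in> Y" for t
    using line line_in_Y[of \<omega>] by (auto simp: parallel_geodesics_def parallel_iff geodesic_on_def)
  have "d (?h (\<omega> (\<epsilon> * t))) (\<omega> t) \<le> B" for t
  proof -
    have "d (?h (\<omega> (\<epsilon> * t))) (\<omega> t) = d (\<omega> (\<epsilon> * t)) (g (\<omega> (\<epsilon> * (\<epsilon> * t))))"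
      using g_dist[OF gh(2)[OF \<omega>Y] \<omega>Y, of "\<epsilon> * t" t] gh(1)[OF \<omega>Y] \<epsilon> by auto
    also have "\<dots> \<le> B" using B commute by metis
    finally show ?thesis .
  qed
  then show ?thesis using that[OF \<epsilon>] isometry_line[OF iso \<epsilon> B] isometry_line[OF h \<epsilon>] by blast
qed

section \<open>The induced isometry of the space of lines\<close>

lemma range_reparam:
  fixes \<epsilon> :: real
  assumes "\<epsilon> = 1 \<or> \<epsilon> = -1"
  shows "range (\<lambda>t. f (\<epsilon> * t)) = range f"
proof -
  have "f t = f (\<epsilon> * (\<epsilon> * t))" for t using assms by auto
  then show ?thesis by blast
qed

lemma image_line: "A \<in> Ls \<Longrightarrow> g ` A \<in> Ls"
proof -
  assume "A \<in> Ls"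
  then obtain \<gamma> where \<gamma>: "\<gamma> \<in> P" "A = range \<gamma>" by (auto simp: parallel_lines_def)
  obtain \<epsilon> :: real where \<epsilon>: "\<epsilon> = 1 \<or> \<epsilon> = -1" "(\<lambda>t. g (\<gamma> (\<epsilon> * t))) \<in> P"
    using orientation \<gamma>(1) by metis
  have "g ` A = range (\<lambda>t. g (\<gamma> (\<epsilon> * t)))"
    using range_reparam[OF \<epsilon>(1), of "\<lambda>t. g (\<gamma> t)"] \<gamma>(2) by (simp add: image_image)
  with \<epsilon>(2) show ?thesis by (auto simp: parallel_lines_def)
qed

text \<open>Pairs of points on two lines correspond under \<open>g\<close> to pairs on the image
  lines at the same distance, so the least distances agree.\<close>

lemma iso_lines: "isometry_of Ls dH g\<omega>"
  unfolding isometry_of_def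
proof (intro conjI ballI)
  have bij: "bij_betw g Y Y" using iso by (simp add: isometry_of_def)
  then have inj: "inj_on g Y" and im: "g ` Y = Y" by (auto simp: bij_betw_def)
  have "A \<in> g\<omega> ` Ls" if A: "A \<in> Ls" for A
  proof -
    obtain \<gamma> where \<gamma>: "\<gamma> \<in> P" "A = range \<gamma>" using A by (auto simp: parallel_lines_def)
    obtain \<epsilon> :: real where \<epsilon>: "\<epsilon> = 1 \<or> \<epsilon> = -1" "(\<lambda>t. inv_into Y g (\<gamma> (\<epsilon> * t))) \<in> P"
      using orientation \<gamma>(1) by metis
    have "g (inv_into Y g (\<gamma> t)) = \<gamma> t" for t
      using line_in_Y[OF \<gamma>(1)] im by (simp add: f_inv_into_f)
    then have "g ` range (\<lambda>t. inv_into Y g (\<gamma> (\<epsilon> * t))) = A"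
      using range_reparam[OF \<epsilon>(1), of \<gamma>] \<gamma>(2) by (simp add: image_image)
    with \<epsilon>(2) show ?thesis by (auto simp: parallel_lines_def)
  qed
  moreover have "inj_on g\<omega> Ls"
    by (rule inj_onI) (metis Ls_subset_Y inj inj_on_image_eq_iff subsetI)
  ultimately show "bij_betw g\<omega> Ls Ls" using image_line by (auto simp: bij_betw_def)
  fix A B assume AB: "A \<in> Ls" "B \<in> Ls"
  note gAB = image_line[OF AB(1)] image_line[OF AB(2)]
  obtain x y where xy: "x \<in> A" "y \<in> B" "d x y = dH A B"
    using line_exists[OF AB(1)] hausdorff_dist_attained_right[OF AB] by metis
  have "dH (g ` A) (g ` B) \<le> dH A B"
    using hausdorff_dist_le[OF gAB, of "g x" "g y"] g_dist xy Ls_subset_Y AB by simp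
  moreover obtain v w where vw: "v \<in> A" "w \<in> B" "d (g v) (g w) = dH (g ` A) (g ` B)"
    using line_exists[OF gAB(1)] hausdorff_dist_attained_right[OF gAB] by blast
  then have "dH A B \<le> dH (g ` A) (g ` B)"
    using hausdorff_dist_le[OF AB, of v w] g_dist Ls_subset_Y AB by simp
  ultimately show "dH (g ` A) (g ` B) = dH A B" by simp
qed

section \<open>Linearly growing orbits and minimal displacement\<close>

lemma funpow_image: "(g\<omega> ^^ n) A = (g ^^ n) ` A"
  by (induction n) (auto simp: image_image)

lemma is_midpoint_image:
  assumes "x \<in> Y" "y \<in> Y" "is_midpoint x y m"
  shows "is_midpoint (g x) (g y) (g m)"
proof -
  have m: "m \<in> Y" using midpoint_in_Y assms by blast
  then show ?thesis using assms g_dist Y_subset_M[OF g_closed[OF m]] by (simp add: is_midpoint_def)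
qed

text \<open>Applying \<open>g\<close> repeatedly makes each orbit point the midpoint of its
  neighbours, so the distance from \<open>x\<close> along the orbit is a midpoint-convex sequence
  starting at zero.\<close>

lemma orbit_of_midpoint:
  assumes x: "x \<in> Y" and m: "is_midpoint x (g (g x)) (g x)"
  shows "d x ((g ^^ n) x) = real n * d x (g x)"
proof (rule antisym)
  show "d x ((g ^^ n) x) \<le> real n * d x (g x)" using pts.funpow_displacement[OF iso x] .
  note cl = Y_subset_M[OF gpow_closed[OF x]]
  have mid: "is_midpoint ((g ^^ n) x) ((g ^^ Suc (Suc n)) x) ((g ^^ Suc n) x)" for n
  proof (induction n)
    case (Suc n)
    then show ?case using is_midpoint_image[OF gpow_closed[OF x] gpow_closed[OF x] Suc] by simp
  qed (use m in simp)
  have "2 * d x ((g ^^ Suc n) x) \<le> d x ((g ^^ n) x) + d x ((g ^^ Suc (Suc n)) x)" for n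
    using midpoint_convex_point[OF Y_subset_M[OF x] cl cl mid] .
  from midpoint_convex_seq[of "\<lambda>n. d x ((g ^^ n) x)" n, OF this]
  show "real n * d x (g x) \<le> d x ((g ^^ n) x)" using Y_subset_M[OF x] by simp
qed

text \<open>The midpoint \<open>m\<close> of \<open>x\<close> and \<open>g x\<close> moves to the
  midpoint of \<open>g x\<close> and \<open>g (g x)\<close>. Convexity seen from \<open>g x\<close>
  bounds this displacement by half of \<open>d x (g (g x))\<close>, and minimality bounds it below
  by \<open>d x (g x)\<close>.\<close>

lemma midpoint_of_minimal:
  assumes x: "x \<in> Y" and min: "\<And>z. z \<in> Y \<Longrightarrow> d x (g x) \<le> d z (g z)"
  shows "is_midpoint x (g (g x)) (g x)"
proof -
  note gx = g_closed[OF x] note ggx = g_closed[OF gx]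
  note M = Y_subset_M[OF x] Y_subset_M[OF gx] Y_subset_M[OF ggx]
  obtain m where m: "is_midpoint x (g x) m" using midpoint_exists M by blast
  have gm: "is_midpoint (g x) (g (g x)) (g m)" using is_midpoint_image[OF x gx m] .
  have "is_midpoint (g x) x m" using m by (auto simp: is_midpoint_def commute)
  then have "2 * d m (g m) \<le> d (g x) (g x) + d x (g (g x))"
    using midpoint_convex[OF M(2,1) M(2,3) _ gm] by blast
  then have "2 * d x (g x) \<le> d x (g (g x))"
    using min[OF midpoint_in_Y[OF x gx m]] M by simp
  then show ?thesis using is_midpointI[OF M(1,3,2)] g_dist[OF x gx] by simp
qed

lemma hyperbolic_of_orbit:
  assumes x: "x \<in> Y" and orb: "\<And>n. d x ((g ^^ n) x) = real n * d x (g x)" and pos: "0 < d x (g x)"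
  shows "hyperbolic Y d g"
  using pts.displacement_minimal[OF iso x] orb pos x
  by (subst pts.hyperbolic_iff[OF iso]) (auto intro!: bexI[of _ x])

text \<open>Linear growth makes the \<open>n\<close>-th iterate of \<open>x\<close> the midpoint of
  \<open>x\<close> and the \<open>2 * n\<close>-th one, so the distance from \<open>A\<close> to its
  iterates doubles whenever the exponent doubles.\<close>

lemma lines_minimal:
  assumes x: "x \<in> Y" and orb: "\<And>n. d x ((g ^^ n) x) = real n * d x (g x)"
    and A: "A \<in> Ls" "x \<in> A" and B: "B \<in> Ls"
  shows "dH A (g ` A) \<le> dH B (g ` B)"
proof (rule lines.displacement_minimal[OF iso_lines A(1) B])
  note M = Y_subset_M[OF gpow_closed[OF x]]
  have cl: "(g ^^ n) ` A \<in> Ls" for n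
    using lines.funpow_closed[OF iso_lines A(1), of n] by (simp add: funpow_image)
  have double: "dH A ((g ^^ (n + n)) ` A) = 2 * dH A ((g ^^ n) ` A)" for n
  proof (rule hausdorff_dist_midline[OF A(1) cl cl A(2)])
    have "d ((g ^^ n) x) ((g ^^ (n + n)) x) = d x ((g ^^ n) x)"
      using pts.funpow_dist[OF iso x gpow_closed[OF x]] by (simp add: funpow_add)
    then show "is_midpoint x ((g ^^ (n + n)) x) ((g ^^ n) x)"
      using is_midpointI[OF Y_subset_M[OF x] M M] orb by simp
  qed (use A in auto)
  have "dH A ((g ^^ (2 ^ k)) ` A) = 2 ^ k * dH A (g ` A)" for k
  proof (induction k)
    case (Suc k)
    have "(2 :: nat) ^ Suc k = 2 ^ k + 2 ^ k" by simp
    then have "dH A ((g ^^ (2 ^ Suc k)) ` A) = 2 * dH A ((g ^^ (2 ^ k)) ` A)"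
      using double by (simp only:)
    with Suc show ?case by simp
  qed simp
  then show "dH A ((g\<omega> ^^ (2 ^ k)) A) = 2 ^ k * dH A (g ` A)" for k by (simp add: funpow_image)
qed

section \<open>Transfer between \<open>g\<close> and the induced isometry, invariant lines and
  axes\<close>

lemma semisimple_lines_of_orbit:
  assumes "x \<in> Y" "\<And>n. d x ((g ^^ n) x) = real n * d x (g x)" "A \<in> Ls" "x \<in> A"
  shows "if g ` A = A then elliptic Ls dH g\<omega> else hyperbolic Ls dH g\<omega>"
proof (cases "g ` A = A")
  case True
  then show ?thesis using lines.elliptic_iff[OF iso_lines] assms(3) by auto
next
  case False
  then have "0 < dH A (g ` A)"
    using lines.nonneg_on[OF assms(3) image_line[OF assms(3)]]
      lines.zero_on[OF assms(3) image_line[OF assms(3)]] by auto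
  with False show ?thesis
    using lines.hyperbolic_iff[OF iso_lines] lines_minimal[OF assms] assms(3) by auto
qed

text \<open>On the parameter \<open>g\<close> acts as an isometry of the reals; a reflection fixes
  the parameter \<open>\<phi> 0 / 2\<close>.\<close>

lemma invariant_line:
  assumes \<xi>: "\<And>s t. d (\<xi> s) (\<xi> t) = \<bar>t - s\<bar>" "\<And>t. \<xi> t \<in> Y" and inv: "g ` range \<xi> = range \<xi>"
  obtains (fixed) t where "g (\<xi> t) = \<xi> t"
    | (translation) \<tau> where "\<And>t. g (\<xi> t) = \<xi> (t + \<tau>)"
proof -
  have "\<exists>s. g (\<xi> t) = \<xi> s" for t using inv by blast
  then obtain \<phi> where \<phi>: "\<And>t. g (\<xi> t) = \<xi> (\<phi> t)" by metis
  have "\<bar>\<phi> s - \<phi> t\<bar> = \<bar>s - t\<bar>" for s t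
    using g_dist[OF \<xi>(2) \<xi>(2), of s t] by (simp add: \<phi> \<xi>(1) abs_minus_commute)
  from isometry_of_real[of \<phi>, OF this] show ?thesis
  proof
    assume "\<forall>t. \<phi> t = \<phi> 0 + t"
    then show ?thesis using translation[of "\<phi> 0"] \<phi> by (metis add.commute)
  next
    assume "\<forall>t. \<phi> t = \<phi> 0 - t"
    then have "\<phi> (\<phi> 0 / 2) = \<phi> 0 / 2" by (metis field_sum_of_halves add_diff_cancel_right')
    then show ?thesis using fixed \<phi> by metis
  qed
qed

lemma orbit_of_translation:
  assumes \<xi>: "\<And>s t. d (\<xi> s) (\<xi> t) = \<bar>t - s\<bar>" and \<tau>: "\<And>t. g (\<xi> t) = \<xi> (t + \<tau>)"
  shows "d (\<xi> 0) ((g ^^ n) (\<xi> 0)) = real n * d (\<xi> 0) (g (\<xi> 0))"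
proof -
  have "(g ^^ n) (\<xi> 0) = \<xi> (real n * \<tau>)"
    by (induction n) (simp_all add: \<tau> algebra_simps)
  then show ?thesis by (simp add: \<xi> \<tau> abs_mult)
qed

text \<open>The line through a fixed point meets its own image, hence equals it.\<close>

lemma elliptic_lines_if_elliptic:
  assumes "elliptic Y d g"
  shows "elliptic Ls dH g\<omega>"
proof -
  obtain x where x: "x \<in> Y" "g x = x" using assms pts.elliptic_iff[OF iso] by blast
  obtain \<gamma> where "\<gamma> \<in> P" "\<gamma> 0 = x" using line_through[OF x(1)] by blast
  then have A: "range \<gamma> \<in> Ls" "x \<in> range \<gamma>" by (auto simp: parallel_lines_def)
  have "x \<in> g ` range \<gamma>" using A(2) x(2) by (metis image_eqI)
  then have "g ` range \<gamma> = range \<gamma>" using Ls_eq_of_meet image_line A by blast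
  then show ?thesis using lines.elliptic_iff[OF iso_lines] A(1) by blast
qed

text \<open>Without a fixed point on it, an invariant line is translated, and the orbits of a
  translation grow linearly.\<close>

lemma semisimple_if_elliptic_lines:
  assumes "elliptic Ls dH g\<omega>"
  shows "elliptic Y d g \<or> hyperbolic Y d g"
proof -
  obtain A where "A \<in> Ls" and inv: "g ` A = A" using assms lines.elliptic_iff[OF iso_lines] by blast
  then obtain \<gamma> where \<gamma>: "\<gamma> \<in> P" "A = range \<gamma>" by (auto simp: parallel_lines_def)
  note D = line_dist[OF \<gamma>(1)] and in_Y = line_in_Y[OF \<gamma>(1)]
  show ?thesis
  proof (cases "\<exists>t. g (\<gamma> t) = \<gamma> t")
    case True
    then show ?thesis using pts.elliptic_iff[OF iso] in_Y by blast
  next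
    case False
    then obtain \<tau> where \<tau>: "\<And>t. g (\<gamma> t) = \<gamma> (t + \<tau>)"
      using invariant_line[OF D in_Y] inv \<gamma>(2) by metis
    have "0 < d (\<gamma> 0) (g (\<gamma> 0))"
      using False in_Y g_closed pts.zero_on nonneg by (metis order_le_less)
    then show ?thesis using hyperbolic_of_orbit[OF in_Y orbit_of_translation[OF D \<tau>]] by blast
  qed
qed

lemma hyperbolic_orbit:
  assumes "hyperbolic Y d g"
  shows "\<exists>x\<in>Y. \<forall>n. d x ((g ^^ n) x) = real n * d x (g x)"
  using assms pts.hyperbolic_iff[OF iso] midpoint_of_minimal orbit_of_midpoint by blast

lemma semisimple_lines_if_hyperbolic:
  assumes "hyperbolic Y d g"
  shows "semisimple Ls dH g\<omega>"
proof -
  obtain x where x: "x \<in> Y" "\<And>n. d x ((g ^^ n) x) = real n * d x (g x)"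
    using hyperbolic_orbit[OF assms] by blast
  obtain \<gamma> where "\<gamma> \<in> P" "\<gamma> 0 = x" using line_through[OF x(1)] by blast
  then have A: "range \<gamma> \<in> Ls" "x \<in> range \<gamma>" by (auto simp: parallel_lines_def)
  show ?thesis using semisimple_lines_of_orbit[OF x A] by (auto simp: semisimple_def split: if_splits)
qed

lemma elliptic_lines_if_axis_parallel:
  assumes \<xi>: "axis_of Y d g \<xi>" and par: "parallel d \<xi> \<omega> \<or> parallel d \<xi> (reverse_line \<omega>)"
  shows "elliptic Ls dH g\<omega>"
proof -
  have D: "\<And>s t. d (\<xi> s) (\<xi> t) = \<bar>t - s\<bar>" and in_Y: "\<And>t. \<xi> t \<in> Y" and inv: "g ` range \<xi> = range \<xi>"
    using \<xi> by (auto simp: axis_of_def geodesic_on_def)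
  note M = Y_subset_M[OF in_Y]
  have \<omega>: "\<omega> \<in> P" using line by (auto simp: parallel_geodesics_def parallel_iff geodesic_on_def)
  have "range \<xi> \<in> Ls"
    using par
  proof
    assume "parallel d \<xi> \<omega>"
    then have "\<xi> \<in> P" using parallel_geodesicsI[OF D M \<omega>] by (auto simp: parallel_iff)
    then show ?thesis by (auto simp: parallel_lines_def)
  next
    assume "parallel d \<xi> (reverse_line \<omega>)"
    then obtain B where B: "\<And>t. d (\<xi> t) (\<omega> (- t)) \<le> B" by (auto simp: parallel_iff reverse_line_def)
    have "d (\<xi> (- t)) (\<omega> t) \<le> B" for t using B[of "- t"] by simp
    moreover have "d (\<xi> (- s)) (\<xi> (- t)) = \<bar>t - s\<bar>" for s t by (simp add: D)
    ultimately have "(\<lambda>t. \<xi> (- t)) \<in> P" using parallel_geodesicsI[of "\<lambda>t. \<xi> (- t)", OF _ M \<omega>] by blast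
    moreover have "range (\<lambda>t. \<xi> (- t)) = range \<xi>" using range_reparam[of "-1" \<xi>] by simp
    ultimately show ?thesis unfolding parallel_lines_def by (metis imageI)
  qed
  with inv show ?thesis using lines.elliptic_iff[OF iso_lines] by blast
qed

text \<open>Both lines start at the same point and are translated by the same length. Up to
  orientation of \<open>\<gamma>\<close>, the distance between them is therefore periodic, hence
  bounded.\<close>

lemma axis_parallel_if_invariant_line:
  assumes \<xi>: "axis_of Y d g \<xi>" and \<gamma>: "\<gamma> \<in> P" "\<gamma> 0 = \<xi> 0" and inv: "g ` range \<gamma> = range \<gamma>"
  shows "parallel d \<xi> \<omega> \<or> parallel d \<xi> (reverse_line \<omega>)"
proof -
  have D: "\<And>s t. d (\<xi> s) (\<xi> t) = \<bar>t - s\<bar>" and in_Y: "\<And>t. \<xi> t \<in> Y" and inv\<xi>: "g ` range \<xi> = range \<xi>"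
    and nofix: "\<And>y. y \<in> Y \<Longrightarrow> g y \<noteq> y"
    using \<xi> by (auto simp: axis_of_def geodesic_on_def)
  note D\<gamma> = line_dist[OF \<gamma>(1)] and in_Y\<gamma> = line_in_Y[OF \<gamma>(1)]
  obtain \<tau> where \<tau>: "\<And>t. g (\<xi> t) = \<xi> (t + \<tau>)" using invariant_line[OF D in_Y inv\<xi>] nofix in_Y by metis
  obtain \<tau>' where \<tau>': "\<And>t. g (\<gamma> t) = \<gamma> (t + \<tau>')"
    using invariant_line[OF D\<gamma> in_Y\<gamma> inv] nofix in_Y\<gamma> by metis
  have \<tau>0: "\<tau> \<noteq> 0" using \<tau>[of 0] nofix[OF in_Y] by auto
  have "\<bar>\<tau>'\<bar> = \<bar>\<tau>\<bar>"
    using D[of 0 \<tau>] D\<gamma>[of 0 \<tau>'] \<tau>[of 0] \<tau>'[of 0] \<gamma>(2) by simp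
  then obtain \<epsilon> :: real where \<epsilon>: "\<epsilon> = 1 \<or> \<epsilon> = -1" "\<tau>' = \<epsilon> * \<tau>"
    by (metis abs_eq_iff mult_1 mult_minus1)
  define f where "f = (\<lambda>t. d (\<xi> t) (\<gamma> (\<epsilon> * t)))"
  have per: "f (t + \<tau>) = f t" for t
    using g_dist[OF in_Y in_Y\<gamma>, of t "\<epsilon> * t"] by (simp add: f_def \<tau> \<tau>' \<epsilon>(2) distrib_left)
  have pern: "f (t + real n * \<tau>) = f t" for t n
  proof (induction n)
    case (Suc n)
    then show ?case using per[of "t + real n * \<tau>"] by (simp add: algebra_simps)
  qed simp
  have perz: "f (t + of_int k * \<tau>) = f t" for t k
  proof (cases "0 \<le> k")
    case True
    then show ?thesis using pern[of t "nat k"] by simp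
  next
    case False
    then show ?thesis using pern[of "t + of_int k * \<tau>" "nat (- k)"] by (simp add: algebra_simps)
  qed
  have f: "f t \<le> 2 * \<bar>\<tau>\<bar>" for t
  proof -
    \<comment> \<open>Removing \<open>k\<close> periods leaves \<open>r\<close> with absolute value
      at most that of \<open>\<tau>\<close>; the path through the common point
      \<open>\<xi> 0\<close> then bounds \<open>f r\<close>.\<close>
    define k where "k = \<lfloor>t / \<tau>\<rfloor>"
    define r where "r = t - of_int k * \<tau>"
    have "\<bar>t / \<tau> - of_int k\<bar> \<le> 1" unfolding k_def by linarith
    moreover have "r = (t / \<tau> - of_int k) * \<tau>" using \<tau>0 by (simp add: r_def algebra_simps)
    ultimately have "\<bar>r\<bar> \<le> \<bar>\<tau>\<bar>" by (simp add: abs_mult mult_left_le_one_le)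
    moreover have "f r \<le> d (\<xi> r) (\<xi> 0) + d (\<gamma> 0) (\<gamma> (\<epsilon> * r))"
      using pts.triangle_on[of "\<xi> r" "\<xi> 0" "\<gamma> (\<epsilon> * r)"] in_Y in_Y\<gamma> \<gamma>(2) by (simp add: f_def)
    moreover have "d (\<xi> r) (\<xi> 0) = \<bar>r\<bar>" "d (\<gamma> 0) (\<gamma> (\<epsilon> * r)) = \<bar>r\<bar>" using D D\<gamma> \<epsilon>(1) by auto
    moreover have "f t = f r" using perz[of r k] by (simp add: r_def)
    ultimately show ?thesis by linarith
  qed
  have \<omega>: "\<omega> \<in> P" using line by (auto simp: parallel_geodesics_def parallel_iff geodesic_on_def)
  obtain C where C: "\<And>t. d (\<gamma> t) (\<omega> t) \<le> C" using parallel_bounded[OF \<gamma>(1) \<omega>] by blast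
  have "d (\<xi> t) (\<omega> (\<epsilon> * t)) \<le> 2 * \<bar>\<tau>\<bar> + C" for t
    using pts.triangle_on[OF in_Y in_Y\<gamma> line_in_Y[OF \<omega>], of t "\<epsilon> * t" "\<epsilon> * t"] f[of t] C[of "\<epsilon> * t"]
    by (simp add: f_def)
  then have "\<exists>B. \<forall>t. d (\<xi> t) (\<omega> (\<epsilon> * t)) \<le> B" by blast
  then show ?thesis using \<epsilon>(1) unfolding parallel_iff reverse_line_def by fastforce
qed

text \<open>The orbit of \<open>\<xi> 0\<close> grows linearly, so the line of the foliation through
  \<open>\<xi> 0\<close> has minimal displacement; were it invariant, the axis would be parallel to
  \<open>\<omega>\<close> or its reverse.\<close>

lemma hyperbolic_lines_if_axis_not_parallel:
  assumes \<xi>: "axis_of Y d g \<xi>" and npar: "\<not> (parallel d \<xi> \<omega> \<or> parallel d \<xi> (reverse_line \<omega>))"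
  shows "hyperbolic Ls dH g\<omega>"
proof -
  have D: "\<And>s t. d (\<xi> s) (\<xi> t) = \<bar>t - s\<bar>" and in_Y: "\<And>t. \<xi> t \<in> Y" and inv: "g ` range \<xi> = range \<xi>"
    and nofix: "\<And>y. y \<in> Y \<Longrightarrow> g y \<noteq> y"
    using \<xi> by (auto simp: axis_of_def geodesic_on_def)
  obtain \<tau> where \<tau>: "\<And>t. g (\<xi> t) = \<xi> (t + \<tau>)" using invariant_line[OF D in_Y inv] nofix in_Y by metis
  obtain \<gamma> where \<gamma>: "\<gamma> \<in> P" "\<gamma> 0 = \<xi> 0" using line_through[OF in_Y] by blast
  then have A: "range \<gamma> \<in> Ls" "\<xi> 0 \<in> range \<gamma>" by (auto simp: parallel_lines_def intro: range_eqI[OF sym])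
  show ?thesis
    using semisimple_lines_of_orbit[OF in_Y orbit_of_translation[OF D \<tau>] A]
      axis_parallel_if_invariant_line[OF \<xi> \<gamma>] npar by (metis (full_types))
qed

lemma hyperbolic_if_hyperbolic_lines:
  assumes "hyperbolic Ls dH g\<omega>"
  shows "hyperbolic Y d g"
proof -
  obtain A where A: "A \<in> Ls" and pos: "0 < dH A (g ` A)"
    and min: "\<And>B. B \<in> Ls \<Longrightarrow> dH A (g ` A) \<le> dH B (g ` B)"
    using assms lines.hyperbolic_iff[OF iso_lines] by blast
  obtain \<gamma> where \<gamma>: "\<gamma> \<in> P" "A = range \<gamma>" using A by (auto simp: parallel_lines_def)
  obtain \<epsilon> :: real where \<epsilon>: "\<epsilon> = 1 \<or> \<epsilon> = -1" and im: "\<And>\<gamma>. \<gamma> \<in> P \<Longrightarrow> (\<lambda>t. g (\<gamma> (\<epsilon> * t))) \<in> P"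
    using orientation by metis
  \<comment> \<open>The sign makes \<open>\<gamma>1\<close> and \<open>\<gamma>2\<close> run
    parallel to \<open>\<gamma>\<close>, as the lemmas on parallel lines require.\<close>
  define \<gamma>1 where "\<gamma>1 = (\<lambda>t. g (\<gamma> (\<epsilon> * t)))"
  define \<gamma>2 where "\<gamma>2 = (\<lambda>t. g (\<gamma>1 (\<epsilon> * t)))"
  have \<gamma>1: "\<gamma>1 \<in> P" and \<gamma>2: "\<gamma>2 \<in> P" using im \<gamma>(1) by (auto simp: \<gamma>1_def \<gamma>2_def)
  have g\<gamma>: "g (\<gamma> t) = \<gamma>1 (\<epsilon> * t)" "g (\<gamma>1 t) = \<gamma>2 (\<epsilon> * t)" for t
    using \<epsilon> by (auto simp: \<gamma>1_def \<gamma>2_def)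
  note in_Y = line_in_Y[OF \<gamma>(1)] line_in_Y[OF \<gamma>1] line_in_Y[OF \<gamma>2]
  note in_M = line_closed[OF \<gamma>(1)] line_closed[OF \<gamma>1] line_closed[OF \<gamma>2]
  have A1: "range \<gamma>1 = g ` A"
    using range_reparam[OF \<epsilon>, of "\<lambda>t. g (\<gamma> t)"] by (simp add: \<gamma>1_def \<gamma>(2) image_image)
  have A2: "range \<gamma>2 = g ` g ` A"
    using range_reparam[OF \<epsilon>, of "\<lambda>t. g (\<gamma>1 t)"] by (simp add: \<gamma>2_def A1[symmetric] image_image)
  note L = A image_line[OF A] image_line[OF image_line[OF A]]
  define \<delta> where "\<delta> = dH A (g ` A)"
  have \<delta>1: "dH (g ` A) (g ` g ` A) = \<delta>" using lines.isometry_dist[OF iso_lines L(1,2)] by (simp add: \<delta>_def)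
  have ge: "2 * \<delta> \<le> dH A (g ` g ` A)"
  proof -
    obtain \<mu> where \<mu>: "\<mu> \<in> P" "\<And>a b. is_midpoint (\<gamma> a) (\<gamma>1 b) (\<mu> ((a + b) / 2))"
      using midline[OF \<gamma>(1) \<gamma>1] by blast
    have \<mu>L: "range \<mu> \<in> Ls" using \<mu> by (auto simp: parallel_lines_def)
    obtain t where t: "d (\<gamma> 0) (\<gamma>2 (\<epsilon> * t)) = dH A (g ` g ` A)"
    proof -
      have "\<gamma> 0 \<in> A" using \<gamma>(2) by simp
      then obtain y where "y \<in> range \<gamma>2" "d (\<gamma> 0) y = dH A (g ` g ` A)"
        using hausdorff_dist_attained_right[OF L(1,3)] unfolding A2 by blast
      then obtain t where "d (\<gamma> 0) (\<gamma>2 t) = dH A (g ` g ` A)" by blast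
      then show ?thesis using that[of "\<epsilon> * t"] \<epsilon> by auto
    qed
    \<comment> \<open>One point of the midline and one of its image, both midpoints with
      \<open>\<gamma>1 0\<close>; the other endpoints \<open>\<gamma> 0\<close> and
      \<open>\<gamma>2 (\<epsilon> * t)\<close> realise the distance between \<open>A\<close> and
      its second image.\<close>
    let ?p = "\<mu> ((0 + 0) / 2)" and ?q = "\<mu> ((0 + t) / 2)"
    have p: "is_midpoint (\<gamma>1 0) (\<gamma> 0) ?p"
      using \<mu>(2)[of 0 0] by (auto simp: is_midpoint_def commute)
    have q: "is_midpoint (\<gamma>1 0) (\<gamma>2 (\<epsilon> * t)) (g ?q)"
      using is_midpoint_image[OF in_Y(1) in_Y(2) \<mu>(2)[of 0 t]] by (simp add: g\<gamma>)
    have "2 * d ?p (g ?q) \<le> dH A (g ` g ` A)"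
      using midpoint_convex[OF in_M(2,1,2,3) p q] t in_M(2) by simp
    moreover have "\<delta> \<le> d ?p (g ?q)"
      using min[OF \<mu>L] hausdorff_dist_le[OF \<mu>L image_line[OF \<mu>L], of ?p "g ?q"]
      unfolding \<delta>_def by auto
    ultimately show ?thesis by linarith
  qed
  obtain u b where u: "d (\<gamma> 0) (\<gamma>1 u) = \<delta>" and b: "d (\<gamma>1 u) (\<gamma>2 b) = \<delta>"
  proof -
    obtain u where u: "d (\<gamma> 0) (\<gamma>1 u) = \<delta>"
    proof -
      have "\<gamma> 0 \<in> A" using \<gamma>(2) by simp
      then obtain y where "y \<in> range \<gamma>1" "d (\<gamma> 0) y = \<delta>"
        using hausdorff_dist_attained_right[OF L(1,2)] unfolding A1 \<delta>_def by blast
      then show ?thesis using that by blast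
    qed
    have "\<gamma>1 u \<in> g ` A" using A1 by blast
    then obtain y where "y \<in> range \<gamma>2" "d (\<gamma>1 u) y = \<delta>"
      using hausdorff_dist_attained_right[OF L(2,3)] unfolding A2 \<delta>1 by blast
    then obtain b where "d (\<gamma>1 u) (\<gamma>2 b) = \<delta>" by blast
    with u show ?thesis using that by blast
  qed
  \<comment> \<open>The endpoints are thus at least \<open>2 * \<delta>\<close> apart, while
    \<open>\<gamma>1 u\<close> is at distance \<open>\<delta>\<close> from each.\<close>
  have "dH A (g ` g ` A) \<le> d (\<gamma> 0) (\<gamma>2 b)" using hausdorff_dist_le[OF L(1,3)] \<gamma>(2) A2 by blast
  with ge u b have "is_midpoint (\<gamma> 0) (\<gamma>2 b) (\<gamma>1 u)"
    by (intro is_midpointI in_M) simp_all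
  from midline_of_midpoint[OF \<gamma>(1) \<gamma>2 \<gamma>1 this] obtain c
    where c: "\<And>s t. is_midpoint (\<gamma> s) (\<gamma>2 t) (\<gamma>1 (c + (s + t) / 2))"
    by (metis (no_types, lifting))
  \<comment> \<open>If \<open>g\<close> preserves orientation, the shear \<open>c\<close> is half a period of a proper function, so it vanishes;
    otherwise \<open>c\<close> is compensated by the choice of the point.\<close>
  have "\<exists>x\<in>A. is_midpoint x (g (g x)) (g x)"
    using \<epsilon>
  proof
    assume 1: "\<epsilon> = 1"
    define F where "F = (\<lambda>t. d (\<gamma> 0) (\<gamma>1 t))"
    have F: "d (\<gamma> s) (\<gamma>1 t) = F (t - s)" for s t
      using parallel_dist[OF \<gamma>(1) \<gamma>1, of 0 s "t - s"] by (simp add: F_def)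
    have "F (c - s) = F (- s - c)" for s
    proof -
      have "d (\<gamma> s) (\<gamma>1 c) = d (\<gamma>1 c) (\<gamma>2 (- s))"
        using c[of s "- s"] by (simp add: is_midpoint_def)
      also have "\<dots> = d (\<gamma> c) (\<gamma>1 (- s))"
        using g_dist[OF in_Y(1,2), of c "- s"] by (simp add: g\<gamma> 1)
      finally show ?thesis by (simp add: F)
    qed
    from this[of "- (_ + c)"] have per: "F (t + 2 * c) = F t" for t by (simp add: algebra_simps)
    have "F (real n * (2 * c)) = F 0" for n
    proof (induction n)
      case (Suc n)
      then show ?case using per[of "real n * (2 * c)"] by (simp add: algebra_simps)
    qed simp
    then have "real n * \<bar>2 * c\<bar> \<le> 2 * F 0" for n
      using dist_ge_parameter[OF \<gamma>(1) \<gamma>1, of "real n * (2 * c)"] by (simp add: F_def abs_mult)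
    then have "\<not> 0 < \<bar>2 * c\<bar>" using ex_less_of_nat_mult[of "\<bar>2 * c\<bar>" "2 * F 0"] by (meson not_less)
    then have "c = 0" by simp
    then show ?thesis using c[of 0 0] 1 \<gamma>(2) by (intro bexI[of _ "\<gamma> 0"]) (auto simp: g\<gamma>)
  next
    assume "\<epsilon> = -1"
    \<comment> \<open>At parameter \<open>- c / 2\<close> the reversal gives
      \<open>g x = \<gamma>1 (c / 2)\<close>, which is where the shifted midline has its
      midpoint.\<close>
    then show ?thesis using c[of "- c / 2" "- c / 2"] \<gamma>(2)
      by (intro bexI[of _ "\<gamma> (- c / 2)"]) (auto simp: g\<gamma>)
  qed
  then obtain x where x: "x \<in> A" "is_midpoint x (g (g x)) (g x)" by blast
  have xY: "x \<in> Y" using Ls_subset_Y[OF A x(1)] .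
  have "0 < d x (g x)" using pos hausdorff_dist_le[OF L(1,2) x(1), of "g x"] x(1) by auto
  then show ?thesis using hyperbolic_of_orbit[OF xY orbit_of_midpoint[OF xY x(2)]] by blast
qed

end

theorem theorem1p3:
  fixes M :: "'a set" and d :: "'a \<Rightarrow> 'a \<Rightarrow> real"
    and \<omega> :: "real \<Rightarrow> 'a" and g :: "'a \<Rightarrow> 'a"
  assumes "busemann_space M d"
    and "geodesic_line M d \<omega>"
    and "isometry_of (parallel_set M d \<omega>) d g"
    and "preserves_foliation d \<omega> g"
  shows "let Y = parallel_set M d \<omega>;
             Ls = parallel_lines M d \<omega>;
             dH = hausdorff_dist d;
             g\<omega> = (\<lambda>L. g ` L)
         in isometry_of Ls dH g\<omega>
          \<and> (elliptic Y d g \<longrightarrow> elliptic Ls dH g\<omega>)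
          \<and> (elliptic Ls dH g\<omega> \<longrightarrow> elliptic Y d g \<or> hyperbolic Y d g)
          \<and> (\<forall>\<xi>. hyperbolic Y d g \<and> axis_of Y d g \<xi> \<longrightarrow>
                (parallel d \<xi> \<omega> \<or> parallel d \<xi> (reverse_line \<omega>) \<longrightarrow> elliptic Ls dH g\<omega>) \<and>
                (\<not> (parallel d \<xi> \<omega> \<or> parallel d \<xi> (reverse_line \<omega>)) \<longrightarrow> hyperbolic Ls dH g\<omega>))
          \<and> (hyperbolic Ls dH g\<omega> \<longrightarrow> hyperbolic Y d g)
          \<and> (semisimple Y d g \<longleftrightarrow> semisimple Ls dH g\<omega>)"
proof -
  interpret foliation_isometry M d \<omega> g
    using assms by (intro foliation_isometry.intro parallel_family.intro
        parallel_family_axioms.intro foliation_isometry_axioms.intro)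
  have "semisimple Y d g \<longleftrightarrow> semisimple Ls dH g\<omega>"
    using elliptic_lines_if_elliptic semisimple_lines_if_hyperbolic semisimple_if_elliptic_lines
      hyperbolic_if_hyperbolic_lines unfolding semisimple_def by blast
  then show ?thesis
    unfolding Let_def
    using iso_lines elliptic_lines_if_elliptic semisimple_if_elliptic_lines
      elliptic_lines_if_axis_parallel hyperbolic_lines_if_axis_not_parallel
      hyperbolic_if_hyperbolic_lines by blast
qed

end
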